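(* Let $\chi(x)=\frac12e^{-|x|}$, $x\in\mathbb{R}$, be the double-exponential kernel. Let $\Pi^*$ be a Type I or Type II location-scale mixture prior with kernel $\frac1\phi\chi\big(\frac{x-\theta}{\phi}\big)$, as defined in the context, satisfying the full support condition (B8) stated there. Let $f_0$ be a continuous density on $\mathbb{R}$ such that (B4) for some $0<M<\infty$, $0<f_0(x)\le M$ for all $x$; (B5) $\left|\int f_0(x)\log f_0(x)\,dx\right|<\infty$; (B6) for some $\delta>0$, $\int f_0(x)\log\frac{f_0(x)}{\phi_\delta(x)}\,dx<\infty$, where $\phi_\delta(x)=\inf_{|t-x|<\delta}f_0(t)$; and $\int_{\mathbb{R}}|x|^{1+\eta}f_0(x)\,dx<\infty$ for some $\eta>0$. Then $f_0\in\mathrm{KL}(\Pi^* )$.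
   Context: $\mathscr{M}(S)$ is the set of probability measures on $S$, $\mathbb{R}^+=(0,\infty)$; a prior is a probability measure on the indicated space; the weak support of a prior on $\mathscr{M}(S)$ is its support in the topology of weak convergence. For a density $\chi$ on $\mathbb{R}$: a Type I location-scale mixture prior $\Pi^*$ is the law of $f_P(x)=\int\frac1\phi\chi\big(\frac{x-\theta}{\phi}\big)dP(\theta,\phi)$ with $P\sim\Pi$, $\Pi$ a prior on $\mathscr{M}(\mathbb{R}\times\mathbb{R}^+)$; condition (B8): the weak support of $\Pi$ is $\mathscr{M}(\mathbb{R}\times\mathbb{R}^+)$. A Type II location-scale mixture prior $\Pi^*$ is the law of $f_{P,\phi}(x)=\int\frac1\phi\chi\big(\frac{x-\theta}{\phi}\big)dP(\theta)$ with independent $P\sim\Pi$ and $\phi\sim\mu$, $\Pi$ a prior on $\mathscr{M}(\mathbb{R})$ and $\mu$ a prior on $(0,\infty)$; condition (B8) then means: the weak support of $\Pi$ is $\mathscr{M}(\mathbb{R})$ and the support of $\mu$ is $(0,\infty)$. $f_0\in\mathrm{KL}(\Pi^* )$ means $\Pi^*(\{f:\int f_0\log(f_0/f)<\epsilon\})>0$ for every $\epsilon>0$. *)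

theory Defs
  imports "HOL-Probability.Probability"
begin

section \<open>Probability measures on a subspace and their weak topology\<close>

definition prob_measures :: "'a::topological_space set \<Rightarrow> 'a measure set" where
  "prob_measures S = space (prob_algebra (restrict_space borel S))"

lemma in_prob_measures_iff:
  "P \<in> prob_measures S \<longleftrightarrow> prob_space P \<and> sets P = sets (restrict_space borel S)"
  by (auto simp: prob_measures_def space_prob_algebra)

definition weak_topology :: "'a::topological_space set \<Rightarrow> 'a measure topology" where
  "weak_topology S = topology_generated_by
     {{P \<in> prob_measures S. (\<integral>z. g z \<partial>P) \<in> U} | g U.
        continuous_on S g \<and> bounded (g ` S) \<and> open (U :: real set)}"

lemma topspace_weak_topology [simp]: "topspace (weak_topology S) = prob_measures S"
proof -
  have "prob_measures S \<in> {{P \<in> prob_measures S. (\<integral>z. g z \<partial>P) \<in> U} | g U.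
        continuous_on S g \<and> bounded (g ` S) \<and> open (U :: real set)}"
    by (rule CollectI, rule exI[of _ "\<lambda>_. 0"], rule exI[of _ UNIV])
       (auto simp: bounded_iff)
  then show ?thesis
    unfolding weak_topology_def topology_generated_by_topspace by blast
qed

text \<open>A prior on the probability measures on \<open>S\<close> is a probability measure on the Borel
  sigma-algebra of the weak topology.\<close>

definition prior_on_measures :: "'a::topological_space set \<Rightarrow> 'a measure measure \<Rightarrow> bool" where
  "prior_on_measures S Q \<longleftrightarrow> prob_space Q \<and>
     sets Q = sets (sigma (prob_measures S) {U. openin (weak_topology S) U})"

definition support_wrt :: "'a topology \<Rightarrow> 'a measure \<Rightarrow> 'a set" where
  "support_wrt T M = {x \<in> topspace T. \<forall>U. openin T U \<longrightarrow> x \<in> U \<longrightarrow> 0 < emeasure M U}"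

section \<open>Densities on the line and laws of random densities\<close>

definition is_density :: "(real \<Rightarrow> real) \<Rightarrow> bool" where
  "is_density f \<longleftrightarrow> f \<in> borel_measurable lborel \<and> (\<forall>x. 0 \<le> f x) \<and>
     (\<integral>\<^sup>+x. ennreal (f x) \<partial>lborel) = 1"

text \<open>The law of a random element \<open>X\<close> of \<open>D\<close> is the image measure on the largest
  sigma-algebra that makes \<open>X\<close> measurable. It extends the image measure on any other
  sigma-algebra on \<open>D\<close> for which \<open>X\<close> is measurable, so no choice of a
  sigma-algebra on the space of densities is involved.\<close>

definition law_on :: "'b set \<Rightarrow> 'a measure \<Rightarrow> ('a \<Rightarrow> 'b) \<Rightarrow> 'b measure" where
  "law_on D M X = distr M (sigma D {A. A \<subseteq> D \<and> X -` A \<inter> space M \<in> sets M}) X"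

lemma space_law_on [simp]: "space (law_on D M X) = D"
  by (auto simp: law_on_def intro!: space_measure_of)

lemma emeasure_law_on:
  assumes X: "X \<in> space M \<rightarrow> D" and A: "A \<subseteq> D" "X -` A \<inter> space M \<in> sets M"
  shows "emeasure (law_on D M X) A = emeasure M (X -` A \<inter> space M)"
proof -
  let ?G = "{A. A \<subseteq> D \<and> X -` A \<inter> space M \<in> sets M}"
  have "X \<in> measurable M (sigma D ?G)"
    using X by (intro measurable_measure_of) auto
  moreover have "A \<in> sets (sigma D ?G)"
    using A by (auto simp: sets_measure_of intro: sigma_sets.Basic)
  ultimately show ?thesis
    by (simp add: law_on_def emeasure_distr)
qed

section \<open>Location-scale mixtures\<close>

definition double_exponential :: "real \<Rightarrow> real" where
  "double_exponential x = exp (- \<bar>x\<bar>) / 2"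

definition loc_scale_kernel :: "(real \<Rightarrow> real) \<Rightarrow> real \<Rightarrow> real \<Rightarrow> real \<Rightarrow> real" where
  "loc_scale_kernel k \<theta> \<phi> x = 1 / \<phi> * k ((x - \<theta>) / \<phi>)"

text \<open>Since scales near \<open>0\<close> make the kernel unbounded, the integral defining
  a mixture over \<open>\<theta>\<close> and \<open>\<phi>\<close> may diverge at some points \<open>x\<close>. These points form a
  Lebesgue null set, on which the density takes the value \<open>0\<close>.\<close>

definition mixture_I :: "(real \<Rightarrow> real) \<Rightarrow> (real \<times> real) measure \<Rightarrow> real \<Rightarrow> real" where
  "mixture_I k P = (\<lambda>x. \<integral>(\<theta>, \<phi>). loc_scale_kernel k \<theta> \<phi> x \<partial>P)"

definition mixture_II :: "(real \<Rightarrow> real) \<Rightarrow> real measure \<Rightarrow> real \<Rightarrow> real \<Rightarrow> real" where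
  "mixture_II k P \<phi> = (\<lambda>x. \<integral>\<theta>. loc_scale_kernel k \<theta> \<phi> x \<partial>P)"

definition mixture_prior_I ::
  "(real \<Rightarrow> real) \<Rightarrow> (real \<times> real) measure measure \<Rightarrow> (real \<Rightarrow> real) measure" where
  "mixture_prior_I k Q = law_on {f. is_density f} Q (mixture_I k)"

definition mixture_prior_II ::
  "(real \<Rightarrow> real) \<Rightarrow> real measure measure \<Rightarrow> real measure \<Rightarrow> (real \<Rightarrow> real) measure" where
  "mixture_prior_II k Q \<mu> = law_on {f. is_density f} (Q \<Otimes>\<^sub>M \<mu>) (\<lambda>(P, \<phi>). mixture_II k P \<phi>)"

definition type_I_full_support_prior :: "(real \<Rightarrow> real) \<Rightarrow> (real \<Rightarrow> real) measure \<Rightarrow> bool" where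
  "type_I_full_support_prior k R \<longleftrightarrow>
     (\<exists>Q. prior_on_measures (UNIV \<times> {0<..}) Q \<and>
          support_wrt (weak_topology (UNIV \<times> {0<..})) Q = prob_measures (UNIV \<times> {0<..}) \<and>
          R = mixture_prior_I k Q)"

definition type_II_full_support_prior :: "(real \<Rightarrow> real) \<Rightarrow> (real \<Rightarrow> real) measure \<Rightarrow> bool" where
  "type_II_full_support_prior k R \<longleftrightarrow>
     (\<exists>Q \<mu>. prior_on_measures UNIV Q \<and> \<mu> \<in> prob_measures {0<..} \<and>
          support_wrt (weak_topology UNIV) Q = prob_measures UNIV \<and>
          support_wrt (top_of_set {0<..}) \<mu> = {0<..} \<and>
          R = mixture_prior_II k Q \<mu>)"

section \<open>The Kullback-Leibler property\<close>

text \<open>The divergence is extended-valued. The Bochner integral would not do here: it is \<open>0\<close> when the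
  integrand is not integrable, and \<open>ln (f\<^sub>0 x / f x)\<close> is \<open>0\<close> when \<open>f x = 0\<close>.\<close>

definition KL_integrand :: "(real \<Rightarrow> real) \<Rightarrow> (real \<Rightarrow> real) \<Rightarrow> real \<Rightarrow> ereal" where
  "KL_integrand f\<^sub>0 f x =
     (if f\<^sub>0 x = 0 then 0 else if f x = 0 then \<infinity> else ereal (f\<^sub>0 x * ln (f\<^sub>0 x / f x)))"

text \<open>The function \<^const>\<open>e2ennreal\<close> maps negative numbers to \<open>0\<close>, so this is the integral of the
  positive part minus the integral of the negative part. The latter is at most \<open>1\<close> for densities,
  because \<open>f\<^sub>0 * ln (f\<^sub>0 / f) \<ge> f\<^sub>0 - f\<close>.\<close>

definition KL_div :: "(real \<Rightarrow> real) \<Rightarrow> (real \<Rightarrow> real) \<Rightarrow> ereal" where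
  "KL_div f\<^sub>0 f =
     enn2ereal (\<integral>\<^sup>+x. e2ennreal (KL_integrand f\<^sub>0 f x) \<partial>lborel) -
     enn2ereal (\<integral>\<^sup>+x. e2ennreal (- KL_integrand f\<^sub>0 f x) \<partial>lborel)"

definition KL_support :: "(real \<Rightarrow> real) measure \<Rightarrow> (real \<Rightarrow> real) set" where
  "KL_support R = {f\<^sub>0. \<forall>\<epsilon>>0. 0 < emeasure R {f \<in> space R. KL_div f\<^sub>0 f < ereal \<epsilon>}}"

definition local_inf :: "(real \<Rightarrow> real) \<Rightarrow> real \<Rightarrow> real \<Rightarrow> real" where
  "local_inf f \<delta> x = (INF t\<in>{t. \<bar>t - x\<bar> < \<delta>}. f t)"

end

theory Submission
  imports Defs "HOL-Real_Asymp.Real_Asymp"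
begin

text \<open>
  Let \<open>K\<^sub>h\<close> be the double-exponential kernel of scale \<open>h\<close> and \<open>f\<^sub>h\<close> the convolution of
  \<open>f\<^sub>0\<close> with \<open>K\<^sub>h\<close>. This is a mixture of the family under consideration: its mixing
  measure \<open>P\<^sub>0\<close> has density \<open>f\<^sub>0\<close> in the location and scale \<open>h\<close>.

  The divergence from \<open>f\<^sub>0\<close> to \<open>f\<^sub>h\<close> tends to 0 with \<open>h\<close>, by dominated convergence
  (\<open>smoothed_KL_small\<close>). The local infimum of \<open>f\<^sub>0\<close> bounds \<open>f\<^sub>h\<close> from below up to a
  constant factor, and \<open>M\<close> bounds it from above. So fix \<open>h\<close>. It remains to show that
  \<open>\<integral> f\<^sub>0 * ln (f\<^sub>h / f)\<close> is small for all mixtures \<open>f\<close> with mixing measure in a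
  weak neighbourhood of \<open>P\<^sub>0\<close>.

  The decisive property of the double-exponential kernel is that its logarithm is Lipschitz in
  \<open>x\<close>, with the inverse scale as constant. The same then holds for every mixture with scales
  bounded below. Therefore finitely many inequalities
  \<open>f(y) > exp (- e / 2) * f\<^sub>h(y)\<close>, each of which is an open condition on the mixing
  measure, keep \<open>ln (f\<^sub>h / f)\<close> below \<open>e\<close> on a compact interval and below
  \<open>e + 2 * L * \<bar>x\<bar>\<close> on the whole line (\<open>weak_nbhd_mixture_lower_bound\<close>). The latter
  bound has a small integral outside a large interval because \<open>f\<^sub>0\<close> has a finite first moment
  (\<open>weak_nbhd_KL_lt\<close>).

  Only lower bounds for \<open>f\<close> are needed, which makes the random scale easy to handle. In Type
  I a continuous cutoff discards scales far from \<open>h\<close> (\<open>KL_ball_pos_I\<close>). In Type II, scales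
  slightly above \<open>h\<close> lose at most a factor \<open>exp e\<close> (\<open>KL_ball_pos_II\<close>). The full support
  of the prior gives positive mass to the neighbourhood, and the resulting event is measurable
  because the Borel sets of the weak topology make all integrals against the random measure
  measurable (\<open>weak_borel_measurable_prob_algebra\<close>).
\<close>

section \<open>The Borel sigma-algebra of the weak topology\<close>

lemma sets_restrict_space_borel:
  "sets (restrict_space borel S) = sigma_sets S {A \<inter> S | A :: 'a::topological_space set. open A}"
proof -
  have "sets (restrict_space borel S) = sets (vimage_algebra S (\<lambda>x. x) (sigma UNIV {A :: 'a set. open A}))"
    unfolding borel_def by (intro restrict_space_eq_vimage_algebra) auto
  also have "\<dots> = sets (sigma S {(\<lambda>x. x) -` A \<inter> S | A. A \<in> {A :: 'a set. open A}})"
    by (subst vimage_algebra_sigma) auto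
  also have "\<dots> = sigma_sets S {A \<inter> S | A :: 'a set. open A}"
    by (subst sets_measure_of) auto
  finally show ?thesis .
qed

lemma openin_weak_topology_basic:
  assumes "continuous_on S g" "bounded (g ` S)" "open (U :: real set)"
  shows "openin (weak_topology S) {P \<in> prob_measures S. (\<integral>z. g z \<partial>P) \<in> U}"
  unfolding weak_topology_def using assms by (intro topology_generated_by_Basis) blast

context
  fixes S :: "'a::topological_space set" and Q
  assumes sets_Q: "sets Q = sets (sigma (prob_measures S) {U. openin (weak_topology S) U})"
begin

lemma space_weak_borel: "space Q = prob_measures S"
  using sets_eq_imp_space_eq[OF sets_Q] openin_subset[of "weak_topology S"]
  by (subst (asm) space_measure_of) auto

lemma openin_weak_in_sets:
  assumes "openin (weak_topology S) U" shows "U \<in> sets Q"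
proof -
  have "{U. openin (weak_topology S) U} \<subseteq> Pow (prob_measures S)"
    using openin_subset[of "weak_topology S"] by auto
  then show ?thesis
    using assms unfolding sets_Q by (subst sets_measure_of) auto
qed

lemma weak_integral_borel_measurable:
  fixes g :: "'a \<Rightarrow> real"
  assumes "continuous_on S g" "bounded (g ` S)"
  shows "(\<lambda>P. \<integral>z. g z \<partial>P) \<in> borel_measurable Q"
proof (rule borel_measurableI)
  fix U :: "real set" assume "open U"
  from openin_weak_in_sets[OF openin_weak_topology_basic[OF assms this]]
  have "{P \<in> prob_measures S. (\<integral>z. g z \<partial>P) \<in> U} \<in> sets Q" .
  moreover have "(\<lambda>P. \<integral>z. g z \<partial>P) -` U \<inter> space Q = {P \<in> prob_measures S. (\<integral>z. g z \<partial>P) \<in> U}"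
    unfolding space_weak_borel by auto
  ultimately show "(\<lambda>P. \<integral>z. g z \<partial>P) -` U \<inter> space Q \<in> sets Q" by simp
qed

end

text \<open>The weak topology makes integrals of bounded continuous functions measurable. The indicator of an
  open set is the limit of the functions \<open>min 1 (n * dist(z, - A))\<close>, so the masses of open
  sets are measurable as well, and these generate the sigma-algebra on the space of probability
  measures. Hence everything known about measurability of kernels applies to a prior.\<close>

lemma weak_borel_measurable_prob_algebra:
  fixes S :: "'a::metric_space set"
  assumes Q: "sets Q = sets (sigma (prob_measures S) {U. openin (weak_topology S) U})"
  shows "(\<lambda>P. P) \<in> Q \<rightarrow>\<^sub>M prob_algebra (restrict_space borel S)"
proof (rule measurable_prob_algebra_generated[OF sets_restrict_space_borel])
  show "Int_stable {A \<inter> S | A. open A}"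
  proof (rule Int_stableI)
    fix a b assume "a \<in> {A \<inter> S | A. open A}" "b \<in> {A \<inter> S | A. open A}"
    then obtain A B where "a = A \<inter> S" "b = B \<inter> S" "open A" "open B" by auto
    then show "a \<inter> b \<in> {A \<inter> S | A. open A}"
      by (intro CollectI exI[of _ "A \<inter> B"]) auto
  qed
  show "prob_space P" "sets P = sets (restrict_space borel S)" if "P \<in> space Q" for P
    using that by (auto simp: space_weak_borel[OF Q] in_prob_measures_iff)
  fix a assume "a \<in> {A \<inter> S | A. open A}"
  then obtain A where a: "a = A \<inter> S" and A: "open A" by auto
  show "(\<lambda>P. emeasure P a) \<in> borel_measurable Q"
  \<comment> \<open>The distance to the complement is a default value when the complement is empty.\<close>
  proof (cases "A = UNIV")
    case True
    have "emeasure P a = 1" if "P \<in> space Q" for P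
    proof -
      have P: "prob_space P" "sets P = sets (restrict_space borel S)"
        using that by (auto simp: space_weak_borel[OF Q] in_prob_measures_iff)
      have "a = space P"
        using sets_eq_imp_space_eq[OF P(2)] True a by (auto simp: space_restrict_space)
      then show ?thesis using P(1) by (simp add: prob_space.emeasure_space_1)
    qed
    then show ?thesis by (subst measurable_cong[where g = "\<lambda>_. 1"]) auto
  next
    case False
    define g where "g n z = min 1 (real n * infdist z (- A))" for n z
    have g_range: "0 \<le> g n z" "g n z \<le> 1" for n z by (auto simp: g_def infdist_nonneg)
    have g_cont: "continuous_on B (g n)" for n B
      unfolding g_def by (intro continuous_intros)
    have g_lim: "(\<lambda>n. g n z) \<longlonglongrightarrow> indicator A z" for z
    proof (cases "z \<in> A")
      case True
      then have "infdist z (- A) > 0"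
        using A False in_closed_iff_infdist_zero[of "- A" z] infdist_nonneg[of z "- A"]
        by (auto simp: less_le)
      then obtain N where N: "1 < real N * infdist z (- A)"
        using reals_Archimedean3 by blast
      have "\<forall>\<^sub>F n in sequentially. g n z = indicator A z"
      proof (rule eventually_sequentiallyI[of N])
        fix n assume "N \<le> n"
        then have "real N * infdist z (- A) \<le> real n * infdist z (- A)"
          by (intro mult_right_mono) (auto simp: infdist_nonneg)
        then show "g n z = indicator A z" using N True by (auto simp: g_def)
      qed
      then show ?thesis by (rule tendsto_eventually)
    next
      case False
      then show ?thesis by (simp add: g_def)
    qed
    have meas: "(\<lambda>P. measure P a) \<in> borel_measurable Q"
    proof (rule borel_measurable_LIMSEQ_real)
      show "(\<lambda>P. \<integral>z. g n z \<partial>P) \<in> borel_measurable Q" for n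
        using g_range by (intro weak_integral_borel_measurable[OF Q] g_cont)
          (auto simp: bounded_iff intro!: exI[of _ 1])
      fix P assume "P \<in> space Q"
      then have P: "prob_space P" "sets P = sets (restrict_space borel S)"
        by (auto simp: space_weak_borel[OF Q] in_prob_measures_iff)
      interpret prob_space P by fact
      have a_eq: "A \<inter> space P = a"
        using sets_eq_imp_space_eq[OF P(2)] a by (auto simp: space_restrict_space)
      have gm: "g n \<in> borel_measurable P" for n
        unfolding measurable_cong_sets[OF P(2) refl]
        by (intro measurable_restrict_space1 borel_measurable_continuous_onI g_cont)
      have im: "indicator A \<in> borel_measurable P"
        unfolding measurable_cong_sets[OF P(2) refl]
        using A by (intro measurable_restrict_space1) auto
      have "(\<lambda>n. \<integral>z. g n z \<partial>P) \<longlonglongrightarrow> (\<integral>z. indicator A z \<partial>P)"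
        by (rule integral_dominated_convergence[where w = "\<lambda>_. 1"])
           (use gm im g_lim g_range in auto)
      then show "(\<lambda>n. \<integral>z. g n z \<partial>P) \<longlonglongrightarrow> measure P a"
        by (simp add: a_eq)
    qed
    show ?thesis
    proof (subst measurable_cong)
      fix P assume "P \<in> space Q"
      then have "prob_space P" by (auto simp: space_weak_borel[OF Q] in_prob_measures_iff)
      then interpret prob_space P .
      show "emeasure P a = ennreal (measure P a)" by (rule emeasure_eq_measure)
    qed (use meas in measurable)
  qed
qed auto

section \<open>Mixtures as random densities\<close>

text \<open>The Bochner integral of a nonnegative kernel equals the real part of its nonnegative integral,
  also at the points where the latter is infinite. This reduces the claim to nonnegative
  integrals.\<close>

lemma mixture_jointly_measurable:
  assumes Q: "(\<lambda>P. P) \<in> Q \<rightarrow>\<^sub>M prob_algebra N"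
    and k: "(\<lambda>(x, z). k x z) \<in> borel_measurable (L \<Otimes>\<^sub>M N)"
    and nonneg: "\<And>x z. x \<in> space L \<Longrightarrow> z \<in> space N \<Longrightarrow> 0 \<le> (k x z :: real)"
  shows "(\<lambda>(P, x). \<integral>z. k x z \<partial>P) \<in> borel_measurable (Q \<Otimes>\<^sub>M L)"
proof -
  have [measurable]: "(\<lambda>w. fst w) \<in> Q \<Otimes>\<^sub>M L \<rightarrow>\<^sub>M subprob_algebra N"
    using measurable_compose[OF measurable_fst measurable_prob_algebraD[OF Q]] .
  have [measurable]: "(\<lambda>(w, z). k (snd w) z) \<in> borel_measurable ((Q \<Otimes>\<^sub>M L) \<Otimes>\<^sub>M N)"
  proof -
    have "(\<lambda>(w, z). (snd w, z)) \<in> (Q \<Otimes>\<^sub>M L) \<Otimes>\<^sub>M N \<rightarrow>\<^sub>M L \<Otimes>\<^sub>M N" by measurable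
    from measurable_compose[OF this k] show ?thesis by (simp add: case_prod_beta)
  qed
  have "(\<lambda>w. \<integral>\<^sup>+z. ennreal (k (snd w) z) \<partial>fst w) \<in> borel_measurable (Q \<Otimes>\<^sub>M L)"
    by (rule nn_integral_measurable_subprob_algebra2[where N = N]) auto
  then have "(\<lambda>w. enn2real (\<integral>\<^sup>+z. ennreal (k (snd w) z) \<partial>fst w)) \<in> borel_measurable (Q \<Otimes>\<^sub>M L)"
    by measurable
  moreover have "(\<integral>z. k x z \<partial>P) = enn2real (\<integral>\<^sup>+z. ennreal (k x z) \<partial>P)"
    if "(P, x) \<in> space (Q \<Otimes>\<^sub>M L)" for P x
  proof -
    have "P \<in> space (prob_algebra N)" and x: "x \<in> space L"
      using that measurable_space[OF Q] by (auto simp: space_pair_measure)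
    then have P: "sets P = sets N" by (auto simp: space_prob_algebra)
    have sp: "space P = space N" by (rule sets_eq_imp_space_eq[OF P])
    have "k x \<in> borel_measurable N"
      using measurable_compose[OF measurable_Pair1'[OF x, of N] k] by simp
    then have "k x \<in> borel_measurable P" by (simp add: measurable_cong_sets[OF P refl])
    then show ?thesis
      by (rule integral_eq_nn_integral) (auto simp: sp nonneg x)
  qed
  ultimately show ?thesis
    by (subst measurable_cong[where g = "\<lambda>w. enn2real (\<integral>\<^sup>+z. ennreal (k (snd w) z) \<partial>fst w)"])
       (auto)
qed

text \<open>Both claims come from Tonelli: the iterated integral is 1, so the inner one is finite almost
  everywhere.\<close>

lemma
  assumes P: "prob_space P" "sets P = sets N"
    and k: "(\<lambda>(x, z). k x z) \<in> borel_measurable (lborel \<Otimes>\<^sub>M N)"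
    and nonneg: "\<And>x z. z \<in> space N \<Longrightarrow> 0 \<le> (k x z :: real)"
    and one: "\<And>z. z \<in> space N \<Longrightarrow> (\<integral>\<^sup>+x. ennreal (k x z) \<partial>lborel) = 1"
  shows is_density_mixture: "is_density (\<lambda>x. \<integral>z. k x z \<partial>P)"
    and AE_integrable_mixture: "AE x in lborel. integrable P (k x)"
proof -
  interpret P: prob_space P by fact
  interpret pair_sigma_finite lborel P ..
  have sp: "space P = space N" by (rule sets_eq_imp_space_eq[OF P(2)])
  have kP [measurable]: "(\<lambda>(x, z). k x z) \<in> borel_measurable (lborel \<Otimes>\<^sub>M P)"
    using k by (simp add: measurable_cong_sets[OF sets_pair_measure_cong[OF refl P(2)] refl])
  have km: "k x \<in> borel_measurable P" for x
    using measurable_compose[OF measurable_Pair1'[of x lborel P] kP] by simp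
  have "(\<integral>\<^sup>+x. (\<integral>\<^sup>+z. ennreal (k x z) \<partial>P) \<partial>lborel) = (\<integral>\<^sup>+z. (\<integral>\<^sup>+x. ennreal (k x z) \<partial>lborel) \<partial>P)"
    by (rule Fubini'[symmetric]) measurable
  also have "\<dots> = (\<integral>\<^sup>+z. 1 \<partial>P)" by (intro nn_integral_cong one) (simp add: sp)
  also have "\<dots> = 1" by (simp add: P.emeasure_space_1)
  finally have total: "(\<integral>\<^sup>+x. (\<integral>\<^sup>+z. ennreal (k x z) \<partial>P) \<partial>lborel) = 1" .
  have fin: "AE x in lborel. (\<integral>\<^sup>+z. ennreal (k x z) \<partial>P) \<noteq> \<infinity>"
    by (rule nn_integral_noteq_infinite) (measurable, simp add: total)
  show int: "AE x in lborel. integrable P (k x)"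
    using fin
  proof eventually_elim
    case (elim x)
    then show ?case
      by (intro integrableI_nonneg km) (auto simp: sp nonneg top.not_eq_extremum)
  qed
  have eq: "AE x in lborel. (\<integral>\<^sup>+z. ennreal (k x z) \<partial>P) = ennreal (\<integral>z. k x z \<partial>P)"
    using int
  proof eventually_elim
    case (elim x)
    then show ?case by (intro nn_integral_eq_integral) (auto simp: sp nonneg)
  qed
  have "(\<integral>\<^sup>+x. ennreal (\<integral>z. k x z \<partial>P) \<partial>lborel) = 1"
    using nn_integral_cong_AE[OF eq] total by simp
  then show "is_density (\<lambda>x. \<integral>z. k x z \<partial>P)"
    unfolding is_density_def by (auto intro!: integral_nonneg_AE simp: sp nonneg)
qed

lemma KL_div_measurable:
  assumes [measurable]: "f\<^sub>0 \<in> borel_measurable lborel"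
    and [measurable]: "(\<lambda>(\<omega>, x). X \<omega> x) \<in> borel_measurable (M \<Otimes>\<^sub>M lborel)"
  shows "(\<lambda>\<omega>. KL_div f\<^sub>0 (X \<omega>)) \<in> borel_measurable M"
  unfolding KL_div_def KL_integrand_def by measurable

text \<open>The emeasure of a set outside the sigma-algebra is 0, so a lower bound for the probability of
  a Kullback-Leibler ball needs the ball to be measurable. With that, exhibiting an event of
  positive probability inside the ball is enough.\<close>

lemma law_on_KL_ball_pos:
  assumes dens: "\<And>\<omega>. \<omega> \<in> space M \<Longrightarrow> is_density (X \<omega>)"
    and f0: "f\<^sub>0 \<in> borel_measurable lborel"
    and X: "(\<lambda>(\<omega>, x). X \<omega> x) \<in> borel_measurable (M \<Otimes>\<^sub>M lborel)"
    and E: "E \<in> sets M" "0 < emeasure M E"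
    and close: "\<And>\<omega>. \<omega> \<in> E \<Longrightarrow> KL_div f\<^sub>0 (X \<omega>) < ereal \<epsilon>"
  defines "R \<equiv> law_on {f. is_density f} M X"
  shows "0 < emeasure R {f \<in> space R. KL_div f\<^sub>0 f < ereal \<epsilon>}"
proof -
  let ?A = "{f \<in> space R. KL_div f\<^sub>0 f < ereal \<epsilon>}"
  note [measurable] = KL_div_measurable[OF f0 X]
  have pre: "X -` ?A \<inter> space M = {\<omega> \<in> space M. KL_div f\<^sub>0 (X \<omega>) < ereal \<epsilon>}"
    using dens by (auto simp: R_def)
  have "emeasure R ?A = emeasure M (X -` ?A \<inter> space M)"
    unfolding R_def
  proof (rule emeasure_law_on)
    show "X -` {f \<in> space (law_on {f. is_density f} M X). KL_div f\<^sub>0 f < ereal \<epsilon>} \<inter> space M \<in> sets M"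
      using pre unfolding R_def by simp
  qed (use dens in auto)
  also have "\<dots> \<ge> emeasure M E"
    unfolding pre using E(1) close by (intro emeasure_mono) (auto dest: sets.sets_into_space)
  finally show ?thesis using E(2) by order
qed

section \<open>Mixtures in a weak neighbourhood have small divergence\<close>

text \<open>The divergence is a difference of extended integrals. Writing \<open>p, q, a, b\<close> for the
  integrals of the positive and negative parts of the integrand and of \<open>H\<close>, the bound
  \<open>p + b \<le> a + q\<close> holds without any finiteness. The integrability of \<open>H\<close> makes
  \<open>a\<close>, \<open>b\<close> and hence \<open>p\<close> finite, so subtraction is meaningful
  even if \<open>q = \<infinity>\<close>.\<close>

lemma KL_div_le_integral:
  assumes [measurable]: "f\<^sub>0 \<in> borel_measurable lborel" "f \<in> borel_measurable lborel"
    and pos: "\<And>x. 0 < f\<^sub>0 x"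
    and H: "integrable lborel H"
    and le: "AE x in lborel. 0 < f x \<and> f\<^sub>0 x * ln (f\<^sub>0 x / f x) \<le> H x"
  shows "KL_div f\<^sub>0 f \<le> ereal (\<integral>x. H x \<partial>lborel)"
proof -
  define D where "D x = f\<^sub>0 x * ln (f\<^sub>0 x / f x)" for x
  define p q a b where "p = (\<integral>\<^sup>+x. ennreal (D x) \<partial>lborel)" and "q = (\<integral>\<^sup>+x. ennreal (- D x) \<partial>lborel)"
    and "a = (\<integral>\<^sup>+x. ennreal (H x) \<partial>lborel)" and "b = (\<integral>\<^sup>+x. ennreal (- H x) \<partial>lborel)"
  have [measurable]: "D \<in> borel_measurable lborel" "H \<in> borel_measurable lborel"
    using H unfolding D_def by measurable
  have integrand: "AE x in lborel. KL_integrand f\<^sub>0 f x = ereal (D x)"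
    using le
  proof eventually_elim
    case (elim x)
    then show ?case using pos[of x] by (simp add: KL_integrand_def D_def)
  qed
  have "(\<integral>\<^sup>+x. e2ennreal (KL_integrand f\<^sub>0 f x) \<partial>lborel) = p"
    unfolding p_def
  proof (rule nn_integral_cong_AE)
    show "AE x in lborel. e2ennreal (KL_integrand f\<^sub>0 f x) = ennreal (D x)"
      using integrand by eventually_elim simp
  qed
  moreover have "(\<integral>\<^sup>+x. e2ennreal (- KL_integrand f\<^sub>0 f x) \<partial>lborel) = q"
    unfolding q_def
  proof (rule nn_integral_cong_AE)
    show "AE x in lborel. e2ennreal (- KL_integrand f\<^sub>0 f x) = ennreal (- D x)"
      using integrand by eventually_elim simp
  qed
  ultimately have KL: "KL_div f\<^sub>0 f = enn2ereal p - enn2ereal q"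
    by (simp add: KL_div_def)
  have ennreal_max: "ennreal r = ennreal (max 0 r)" for r
    by (simp add: max_def ennreal_neg)
  have sum: "ennreal d + ennreal (- h) \<le> ennreal h + ennreal (- d)" if "d \<le> h" for d h
  proof -
    have "ennreal d + ennreal (- h) = ennreal (max 0 d + max 0 (- h))"
      unfolding ennreal_max[of d] ennreal_max[of "- h"] by (rule ennreal_plus[symmetric]) auto
    also have "\<dots> \<le> ennreal (max 0 h + max 0 (- d))"
      using that by (intro ennreal_leI) auto
    also have "\<dots> = ennreal h + ennreal (- d)"
      unfolding ennreal_max[of h] ennreal_max[of "- d"] by (rule ennreal_plus) auto
    finally show ?thesis .
  qed
  have "p + b = (\<integral>\<^sup>+x. ennreal (D x) + ennreal (- H x) \<partial>lborel)"
    unfolding p_def b_def by (subst nn_integral_add) auto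
  also have "\<dots> \<le> (\<integral>\<^sup>+x. ennreal (H x) + ennreal (- D x) \<partial>lborel)"
  proof (rule nn_integral_mono_AE)
    show "AE x in lborel. ennreal (D x) + ennreal (- H x) \<le> ennreal (H x) + ennreal (- D x)"
      using le by eventually_elim (auto intro!: sum simp: D_def)
  qed
  also have "\<dots> = a + q"
    unfolding a_def q_def by (subst nn_integral_add) auto
  finally have pb: "p + b \<le> a + q" .
  have "p \<le> a"
    unfolding p_def a_def
  proof (rule nn_integral_mono_AE)
    show "AE x in lborel. ennreal (D x) \<le> ennreal (H x)"
      using le by eventually_elim (auto intro!: ennreal_leI simp: D_def)
  qed
  have fin: "a < \<infinity>" "b < \<infinity>"
    using H unfolding a_def b_def real_integrable_def by (auto simp: less_top)
  obtain a' where a': "a = ennreal a'" "0 \<le> a'" using fin(1) by (cases a) auto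
  obtain b' where b': "b = ennreal b'" "0 \<le> b'" using fin(2) by (cases b) auto
  obtain p' where p': "p = ennreal p'" "0 \<le> p'"
    using \<open>p \<le> a\<close> fin(1) by (cases p) (auto simp: top_unique)
  have intH: "(\<integral>x. H x \<partial>lborel) = a' - b'"
    using real_lebesgue_integral_def[OF H] a' b' unfolding a_def[symmetric] b_def[symmetric] by simp
  show ?thesis
  proof (cases q)
    case (real q')
    then have "p' + b' \<le> a' + q'"
      using pb a' b' p' by (simp add: ennreal_plus[symmetric] ennreal_le_iff del: ennreal_plus)
    then show ?thesis using real p' by (simp add: KL intH enn2ereal_ennreal)
  next
    case top
    then show ?thesis using p' by (simp add: KL enn2ereal_ennreal)
  qed
qed

text \<open>For a positive kernel, the assumption on \<open>L\<close> says that \<open>ln (g x z)\<close> is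
  \<open>L\<close>-Lipschitz in \<open>x\<close>, uniformly in \<open>z\<close>; stated multiplicatively, it also allows the
  value 0. The property passes to every mixture. A one-sided inequality at each point
  of a finite net therefore spreads to the whole interval \<open>[- m, m]\<close>. The inequality at the
  point 0 alone spreads to the whole line, at the price of a factor
  \<open>exp (2 * L * \<bar>x\<bar>)\<close>. Finitely many such inequalities define a weakly open set.\<close>

lemma weak_nbhd_mixture_lower_bound:
  fixes S :: "'a::topological_space set" and g :: "real \<Rightarrow> 'a \<Rightarrow> real"
  assumes P0: "P\<^sub>0 \<in> prob_measures S"
    and cont: "\<And>x. continuous_on S (g x)" and bdd: "\<And>x. bounded (g x ` S)"
    and lip: "\<And>x y z. z \<in> S \<Longrightarrow> g x z \<le> exp (L * \<bar>x - y\<bar>) * g y z"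
    and L: "L > 0" and pos: "0 < (\<integral>z. g 0 z \<partial>P\<^sub>0)" and e: "e > 0"
  obtains U where "openin (weak_topology S) U" "P\<^sub>0 \<in> U"
    and "\<And>P x. P \<in> U \<Longrightarrow> \<bar>x\<bar> \<le> m \<Longrightarrow> (\<integral>z. g x z \<partial>P\<^sub>0) \<le> exp e * (\<integral>z. g x z \<partial>P)"
    and "\<And>P x. P \<in> U \<Longrightarrow> (\<integral>z. g x z \<partial>P\<^sub>0) \<le> exp (e + 2 * L * \<bar>x\<bar>) * (\<integral>z. g x z \<partial>P)"
proof -
  define G where "G P x = (\<integral>z. g x z \<partial>P)" for P x
  have G_lip: "G P x \<le> exp (L * \<bar>x - y\<bar>) * G P y" if "P \<in> prob_measures S" for P x y
  proof -
    have P: "prob_space P" "sets P = sets (restrict_space borel S)"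
      using that by (auto simp: in_prob_measures_iff)
    interpret prob_space P by fact
    have sp: "space P = S"
      using sets_eq_imp_space_eq[OF P(2)] by (simp add: space_restrict_space)
    have int: "integrable P (g x)" for x
    proof -
      obtain B where "\<And>z. z \<in> S \<Longrightarrow> \<bar>g x z\<bar> \<le> B"
        using bdd[of x] by (auto simp: bounded_iff)
      moreover have "g x \<in> borel_measurable P"
        unfolding measurable_cong_sets[OF P(2) refl]
        by (rule borel_measurable_continuous_on_restrict[OF cont])
      ultimately show ?thesis by (intro integrable_const_bound[of _ B]) (auto simp: sp)
    qed
    have "G P x \<le> (\<integral>z. exp (L * \<bar>x - y\<bar>) * g y z \<partial>P)"
      unfolding G_def using int lip by (intro integral_mono) (auto simp: sp)
    then show ?thesis by (simp add: G_def)
  qed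
  have G0_pos: "0 < G P\<^sub>0 y" for y
  proof -
    have "0 < exp (L * \<bar>0 - y\<bar>) * G P\<^sub>0 y"
      using G_lip[OF P0, of 0 y] pos unfolding G_def by linarith
    then show ?thesis by (simp add: zero_less_mult_iff)
  qed
  \<comment> \<open>Moving to a net point and back costs twice \<open>L * \<eta>\<close>, which is half of \<open>e\<close>; the net inequalities cost the other half.\<close>
  define \<eta> where "\<eta> = e / (4 * L)"
  have \<eta>: "\<eta> > 0" "L * \<eta> = e / 4" using L e by (auto simp: \<eta>_def)
  obtain N where N: "finite N" "{- m..m} \<subseteq> (\<Union>y\<in>N. ball y \<eta>)"
    using compact_imp_seq_compact[OF compact_Icc, of "- m" m, THEN seq_compact_imp_totally_bounded] \<eta>(1)
    by meson
  define V where "V y = {P \<in> prob_measures S. (\<integral>z. g y z \<partial>P) \<in> {exp (- e / 2) * G P\<^sub>0 y<..}}" for y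
  define U where "U = (\<Inter>y\<in>insert 0 N. V y)"
  have "openin (weak_topology S) (V y)" for y
    unfolding V_def by (intro openin_weak_topology_basic cont bdd) auto
  then have "openin (weak_topology S) U"
    unfolding U_def using N(1) by (intro openin_Inter) auto
  moreover have "P\<^sub>0 \<in> U"
  proof -
    have "exp (- e / 2) * G P\<^sub>0 y < 1 * G P\<^sub>0 y" for y
      using G0_pos[of y] e by (intro mult_strict_right_mono) auto
    then show ?thesis using P0 by (auto simp: U_def V_def G_def)
  qed
  moreover {
    fix P x y assume "P \<in> U" "y \<in> insert 0 N"
    then have P: "P \<in> prob_measures S" and "exp (- e / 2) * G P\<^sub>0 y < G P y"
      by (auto simp: U_def V_def G_def)
    then have y: "G P\<^sub>0 y \<le> exp (e / 2) * G P y"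
      by (simp add: exp_minus field_simps)
    have "G P\<^sub>0 x \<le> exp (L * \<bar>x - y\<bar>) * G P\<^sub>0 y" by (rule G_lip[OF P0])
    also have "\<dots> \<le> exp (L * \<bar>x - y\<bar>) * (exp (e / 2) * G P y)"
      using y by (intro mult_left_mono) auto
    also have "\<dots> \<le> exp (L * \<bar>x - y\<bar>) * (exp (e / 2) * (exp (L * \<bar>y - x\<bar>) * G P x))"
      by (intro mult_left_mono G_lip[OF P]) auto
    also have "\<dots> = exp (e / 2 + 2 * L * \<bar>x - y\<bar>) * G P x"
      by (simp add: abs_minus_commute exp_add[symmetric] mult.assoc[symmetric])
    finally have "G P\<^sub>0 x \<le> exp (e / 2 + 2 * L * \<bar>x - y\<bar>) * G P x" .
    moreover from this have "0 \<le> G P x"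
      using G0_pos[of x] by (smt (verit) exp_gt_zero mult_nonneg_nonpos)
    ultimately have "G P\<^sub>0 x \<le> exp (e / 2 + 2 * L * \<bar>x - y\<bar>) * G P x" "0 \<le> G P x" by auto
  } note key = this
  moreover have "G P\<^sub>0 x \<le> exp e * G P x" if "P \<in> U" "\<bar>x\<bar> \<le> m" for P x
  proof -
    have "x \<in> {- m..m}" using that(2) by auto
    then obtain y where y: "y \<in> N" "\<bar>x - y\<bar> < \<eta>"
      using N(2) by (auto simp: dist_real_def abs_minus_commute)
    then have "L * \<bar>x - y\<bar> \<le> e / 4"
      using L mult_left_mono[of "\<bar>x - y\<bar>" \<eta> L] \<eta>(2) by simp
    then have "exp (e / 2 + 2 * L * \<bar>x - y\<bar>) * G P x \<le> exp e * G P x"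
      using key(2)[OF that(1), of 0 x] by (intro mult_right_mono) auto
    then show ?thesis using key(1)[OF that(1), of y x] y by auto
  qed
  moreover have "G P\<^sub>0 x \<le> exp (e + 2 * L * \<bar>x\<bar>) * G P x" if "P \<in> U" for P x
  proof -
    have "exp (e / 2 + 2 * L * \<bar>x - 0\<bar>) * G P x \<le> exp (e + 2 * L * \<bar>x\<bar>) * G P x"
      using key(2)[OF that, of 0 x] e by (intro mult_right_mono) auto
    then show ?thesis using key(1)[OF that, of 0 x] by auto
  qed
  ultimately show thesis by (intro that[of U]) (auto simp: G_def)
qed

lemma density_borel_measurable: "is_density f \<Longrightarrow> f \<in> borel_measurable borel"
  by (simp add: is_density_def)

lemma integrable_density: "is_density f \<Longrightarrow> integrable lborel f"
  unfolding is_density_def by (intro integrableI_nonneg) auto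

lemma integral_density_eq_1:
  assumes "is_density f" shows "(\<integral>x. f x \<partial>lborel) = 1"
proof -
  have "(\<integral>x. f x \<partial>lborel) = enn2real (\<integral>\<^sup>+x. ennreal (f x) \<partial>lborel)"
    using assms unfolding is_density_def by (intro integral_eq_nn_integral) auto
  then show ?thesis using assms by (simp add: is_density_def)
qed

lemma prob_space_density_lborel: "is_density f \<Longrightarrow> prob_space (density lborel f)"
  by (intro prob_spaceI) (simp add: emeasure_density is_density_def)

text \<open>By the previous lower bound, \<open>ln (F / f)\<close> for the mixture \<open>F\<close> at \<open>P\<^sub>0\<close> is at
  most \<open>2 * e\<close> on \<open>[- m, m]\<close> and at most \<open>2 * e + 2 * L * \<bar>x\<bar>\<close> outside. Since
  \<open>f\<^sub>0\<close> has a finite first moment, the outer part contributes less than \<open>e\<close> once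
  \<open>m\<close> is large. The density \<open>f\<close> is only compared with the mixture of \<open>g\<close> at
  \<open>P\<close>, from one side and up to the factor \<open>exp e\<close>. This leaves room to truncate the kernel
  or to vary its scale.\<close>

lemma weak_nbhd_KL_lt:
  fixes S :: "'a::topological_space set" and g :: "real \<Rightarrow> 'a \<Rightarrow> real"
  assumes P0: "P\<^sub>0 \<in> prob_measures S"
    and cont: "\<And>x. continuous_on S (g x)" and bdd: "\<And>x. bounded (g x ` S)"
    and lip: "\<And>x y z. z \<in> S \<Longrightarrow> g x z \<le> exp (L * \<bar>x - y\<bar>) * g y z"
    and L: "L > 0" and pos: "\<And>x. 0 < (\<integral>z. g x z \<partial>P\<^sub>0)"
    and dens: "is_density f\<^sub>0" and f0_pos: "\<And>x. 0 < f\<^sub>0 x"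
    and moment: "integrable lborel (\<lambda>x. \<bar>x\<bar> * f\<^sub>0 x)"
    and KL0: "integrable lborel (\<lambda>x. f\<^sub>0 x * ln (f\<^sub>0 x / (\<integral>z. g x z \<partial>P\<^sub>0)))"
             "(\<integral>x. f\<^sub>0 x * ln (f\<^sub>0 x / (\<integral>z. g x z \<partial>P\<^sub>0)) \<partial>lborel) + 3 * e < \<epsilon>"
    and e: "e > 0"
  obtains U where "openin (weak_topology S) U" "P\<^sub>0 \<in> U"
    and "\<And>P f. P \<in> U \<Longrightarrow> is_density f \<Longrightarrow>
           (AE x in lborel. (\<integral>z. g x z \<partial>P) \<le> exp e * f x) \<Longrightarrow> KL_div f\<^sub>0 f < ereal \<epsilon>"
proof -
  define F where "F x = (\<integral>z. g x z \<partial>P\<^sub>0)" for x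
  note [measurable] = density_borel_measurable[OF dens]
  note int_f0 = integrable_density[OF dens] integral_density_eq_1[OF dens]
  define T where "T m x = (if \<bar>x\<bar> \<le> m then 0 else \<bar>x\<bar> * f\<^sub>0 x)" for m x
  have T_meas [measurable]: "T m \<in> borel_measurable lborel" for m
    unfolding T_def by measurable
  have T_int: "integrable lborel (T m)" for m
    by (rule Bochner_Integration.integrable_bound[OF moment])
       (use f0_pos in \<open>auto simp: T_def less_imp_le\<close>)
  have "(\<lambda>n. \<integral>x. T (real n) x \<partial>lborel) \<longlonglongrightarrow> (\<integral>x. 0 \<partial>(lborel :: real measure))"
  proof (rule integral_dominated_convergence[where w = "\<lambda>x. \<bar>x\<bar> * f\<^sub>0 x"])
    have "(\<lambda>n. T (real n) x) \<longlonglongrightarrow> 0" for x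
    proof -
      obtain N where N: "\<bar>x\<bar> \<le> real N" using real_arch_simple by blast
      have "\<forall>\<^sub>F n in sequentially. T (real n) x = 0"
        by (rule eventually_sequentiallyI[of N]) (use N in \<open>auto simp: T_def\<close>)
      then show ?thesis by (rule tendsto_eventually)
    qed
    then show "AE x in lborel. (\<lambda>n. T (real n) x) \<longlonglongrightarrow> 0" by simp
  qed (use moment f0_pos in \<open>auto simp: T_def less_imp_le\<close>)
  then have "(\<lambda>n. \<integral>x. T (real n) x \<partial>lborel) \<longlonglongrightarrow> 0" by simp
  moreover have "0 < e / (2 * L)" using e L by simp
  ultimately have "\<forall>\<^sub>F n in sequentially. (\<integral>x. T (real n) x \<partial>lborel) < e / (2 * L)"
    by (rule order_tendstoD(2))
  then obtain n where n: "(\<integral>x. T (real n) x \<partial>lborel) < e / (2 * L)"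
    by (auto simp: eventually_sequentially)
  define m where "m = real n"
  obtain U where U: "openin (weak_topology S) U" "P\<^sub>0 \<in> U"
    and inner: "\<And>P x. P \<in> U \<Longrightarrow> \<bar>x\<bar> \<le> m \<Longrightarrow> F x \<le> exp e * (\<integral>z. g x z \<partial>P)"
    and outer: "\<And>P x. P \<in> U \<Longrightarrow> F x \<le> exp (e + 2 * L * \<bar>x\<bar>) * (\<integral>z. g x z \<partial>P)"
    using weak_nbhd_mixture_lower_bound[OF P0 cont bdd lip L pos e, of m] unfolding F_def by metis
  define H where "H x = f\<^sub>0 x * ln (f\<^sub>0 x / F x) + 2 * e * f\<^sub>0 x + 2 * L * T m x" for x
  have H_int: "integrable lborel H"
    unfolding H_def F_def using KL0(1) int_f0(1) T_int
    by (intro Bochner_Integration.integrable_add integrable_mult_right) auto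
  have "(\<integral>x. H x \<partial>lborel) = (\<integral>x. f\<^sub>0 x * ln (f\<^sub>0 x / F x) \<partial>lborel) + 2 * e + 2 * L * (\<integral>x. T m x \<partial>lborel)"
    unfolding H_def F_def using KL0(1) int_f0 T_int by simp
  also have "\<dots> < (\<integral>x. f\<^sub>0 x * ln (f\<^sub>0 x / F x) \<partial>lborel) + 2 * e + e"
    using n L by (simp add: m_def field_simps)
  also have "\<dots> < \<epsilon>" using KL0(2) by (simp add: F_def)
  finally have H_less: "(\<integral>x. H x \<partial>lborel) < \<epsilon>" .
  show thesis
  proof (rule that[OF U])
    fix P f assume P: "P \<in> U" and f: "is_density f"
      and ae: "AE x in lborel. (\<integral>z. g x z \<partial>P) \<le> exp e * f x"
    have fm: "f \<in> borel_measurable lborel" using f by (simp add: is_density_def)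
    have "AE x in lborel. 0 < f x \<and> f\<^sub>0 x * ln (f\<^sub>0 x / f x) \<le> H x"
      using ae
    proof eventually_elim
      case (elim x)
      define b where "b = (if \<bar>x\<bar> \<le> m then e else e + 2 * L * \<bar>x\<bar>)"
      have F_pos: "0 < F x" using pos by (simp add: F_def)
      have "F x \<le> exp b * (\<integral>z. g x z \<partial>P)"
        using inner[OF P] outer[OF P] by (auto simp: b_def)
      also have "\<dots> \<le> exp b * (exp e * f x)"
        using elim by (intro mult_left_mono) auto
      also have "\<dots> = exp (b + e) * f x" by (simp add: exp_add)
      finally have F_le: "F x \<le> exp (b + e) * f x" .
      then have "0 < exp (b + e) * f x" using F_pos by linarith
      then have fx: "0 < f x" by (simp add: zero_less_mult_iff)
      have "ln (F x) \<le> ln (exp (b + e) * f x)"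
        using F_le F_pos by (intro ln_mono) auto
      also have "\<dots> = b + e + ln (f x)" using fx by (simp add: ln_mult)
      finally have "ln (f\<^sub>0 x / f x) \<le> ln (f\<^sub>0 x / F x) + (b + e)"
        using fx F_pos f0_pos[of x] by (simp add: ln_div)
      then have "f\<^sub>0 x * ln (f\<^sub>0 x / f x) \<le> f\<^sub>0 x * (ln (f\<^sub>0 x / F x) + (b + e))"
        using f0_pos[of x] by (intro mult_left_mono) auto
      also have "\<dots> = H x"
        by (auto simp: H_def T_def b_def algebra_simps)
      finally show ?case using fx by simp
    qed
    then have "KL_div f\<^sub>0 f \<le> ereal (\<integral>x. H x \<partial>lborel)"
      by (intro KL_div_le_integral fm f0_pos H_int) auto
    also have "\<dots> < ereal \<epsilon>" using H_less by simp
    finally show "KL_div f\<^sub>0 f < ereal \<epsilon>" .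
  qed
qed

section \<open>The double-exponential kernel\<close>

lemma loc_scale_double_exponential:
  "0 < \<phi> \<Longrightarrow> loc_scale_kernel double_exponential \<theta> \<phi> x = exp (- \<bar>x - \<theta>\<bar> / \<phi>) / (2 * \<phi>)"
  by (simp add: loc_scale_kernel_def double_exponential_def abs_divide)

lemma double_exponential_measurable [measurable]: "double_exponential \<in> borel_measurable borel"
  unfolding double_exponential_def by measurable

lemma nn_integral_double_exponential: "(\<integral>\<^sup>+x. ennreal (double_exponential x) \<partial>lborel) = 1"
proof -
  have half: "(\<integral>\<^sup>+x. ennreal (exp (- x) / 2) * indicator {0..} x \<partial>lborel) = ennreal (1 / 2)"
  proof -
    have "((\<lambda>x::real. - (exp (- x) / 2)) \<longlongrightarrow> 0) at_top"
      by real_asymp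
    then have "(\<integral>\<^sup>+x. ennreal (exp (- x) / 2) * indicator {0..} x \<partial>lborel)
        = ennreal (0 - - (exp (- 0) / 2))"
      by (intro nn_integral_FTC_atLeast) (auto intro!: derivative_eq_intros)
    then show ?thesis by simp
  qed
  have [measurable]: "(\<lambda>x::real. ennreal (exp (- \<bar>x\<bar>) / 2) * indicator {..0} x) \<in> borel_measurable borel"
    by measurable
  have neg: "(\<integral>\<^sup>+x. ennreal (exp (- \<bar>x\<bar>) / 2) * indicator {..0} x \<partial>lborel) = ennreal (1 / 2)"
    unfolding half[symmetric]
    by (subst nn_integral_real_affine[where c = "-1" and t = 0])
       (auto intro!: nn_integral_cong simp: indicator_def)
  have "(\<integral>\<^sup>+x. ennreal (double_exponential x) \<partial>lborel)
     = (\<integral>\<^sup>+x. ennreal (exp (- x) / 2) * indicator {0..} x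
            + ennreal (exp (- \<bar>x\<bar>) / 2) * indicator {..0} x \<partial>lborel)"
  proof (rule nn_integral_cong_AE)
    show "AE x in lborel. ennreal (double_exponential x) = ennreal (exp (- x) / 2) * indicator {0..} x
            + ennreal (exp (- \<bar>x\<bar>) / 2) * indicator {..0} x"
      using AE_lborel_singleton[of 0]
      by eventually_elim (auto simp: double_exponential_def indicator_def)
  qed
  also have "\<dots> = ennreal (1 / 2) + ennreal (1 / 2)"
    by (subst nn_integral_add) (simp_all add: half neg)
  also have "\<dots> = 1"
    by (subst ennreal_plus[symmetric]) auto
  finally show ?thesis .
qed

lemma double_exponential_is_density: "is_density double_exponential"
  by (simp add: is_density_def nn_integral_double_exponential) (simp add: double_exponential_def)

lemma loc_scale_kernel_nonneg: "0 < \<phi> \<Longrightarrow> 0 \<le> loc_scale_kernel double_exponential \<theta> \<phi> x"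
  by (simp add: loc_scale_double_exponential)

lemma nn_integral_loc_scale_kernel:
  assumes "0 < \<phi>"
  shows "(\<integral>\<^sup>+x. ennreal (loc_scale_kernel double_exponential \<theta> \<phi> x) \<partial>lborel) = 1"
proof -
  have "(\<integral>\<^sup>+x. ennreal (loc_scale_kernel double_exponential \<theta> \<phi> x) \<partial>lborel)
     = ennreal \<bar>\<phi>\<bar> * (\<integral>\<^sup>+x. ennreal (loc_scale_kernel double_exponential \<theta> \<phi> (\<theta> + \<phi> * x)) \<partial>lborel)"
    using assms by (intro nn_integral_real_affine) (auto simp: loc_scale_kernel_def)
  also have "\<dots> = (\<integral>\<^sup>+x. ennreal \<bar>\<phi>\<bar> * ennreal (loc_scale_kernel double_exponential \<theta> \<phi> (\<theta> + \<phi> * x)) \<partial>lborel)"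
    by (intro nn_integral_cmult[symmetric]) (simp add: loc_scale_kernel_def)
  also have "\<dots> = (\<integral>\<^sup>+x. ennreal (double_exponential x) \<partial>lborel)"
    using assms
    by (intro nn_integral_cong) (simp add: loc_scale_kernel_def ennreal_mult'[symmetric] double_exponential_def)
  finally show ?thesis by (simp add: nn_integral_double_exponential)
qed

text \<open>The logarithm of the kernel is \<open>- \<bar>x - \<theta>\<bar> / \<phi>\<close> up to a constant, so the
  triangle inequality gives a Lipschitz constant that depends only on a lower bound of the
  scale.\<close>

lemma loc_scale_kernel_log_lipschitz:
  assumes "0 < h" "h \<le> \<phi>"
  shows "loc_scale_kernel double_exponential \<theta> \<phi> x
           \<le> exp (1 / h * \<bar>x - y\<bar>) * loc_scale_kernel double_exponential \<theta> \<phi> y"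
proof -
  have "\<bar>y - \<theta>\<bar> / \<phi> \<le> \<bar>x - y\<bar> / \<phi> + \<bar>x - \<theta>\<bar> / \<phi>"
    using assms unfolding add_divide_distrib[symmetric] by (intro divide_right_mono) auto
  moreover have "\<bar>x - y\<bar> / \<phi> \<le> \<bar>x - y\<bar> / h"
    using assms by (intro divide_left_mono) auto
  ultimately have "exp (- \<bar>x - \<theta>\<bar> / \<phi>) \<le> exp (1 / h * \<bar>x - y\<bar> + - \<bar>y - \<theta>\<bar> / \<phi>)"
    by simp
  then have "exp (- \<bar>x - \<theta>\<bar> / \<phi>) / (2 * \<phi>) \<le> exp (1 / h * \<bar>x - y\<bar>) * exp (- \<bar>y - \<theta>\<bar> / \<phi>) / (2 * \<phi>)"
    using assms unfolding exp_add by (intro divide_right_mono) auto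
  then show ?thesis
    using assms by (simp add: loc_scale_double_exponential)
qed

section \<open>Smoothing at a small scale\<close>

definition smoothed :: "(real \<Rightarrow> real) \<Rightarrow> real \<Rightarrow> real \<Rightarrow> real" where
  "smoothed f h x = (\<integral>\<theta>. loc_scale_kernel double_exponential \<theta> h x * f \<theta> \<partial>lborel)"

lemma smoothed_eq:
  assumes "0 < h"
  shows "smoothed f h x = (\<integral>u. double_exponential u * f (x + h * u) \<partial>lborel)"
proof -
  have "smoothed f h x
      = \<bar>h\<bar> *\<^sub>R (\<integral>u. loc_scale_kernel double_exponential (x + h * u) h x * f (x + h * u) \<partial>lborel)"
    unfolding smoothed_def using assms by (intro lborel_integral_real_affine) auto
  also have "\<dots> = (\<integral>u. \<bar>h\<bar> * (loc_scale_kernel double_exponential (x + h * u) h x * f (x + h * u)) \<partial>lborel)"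
    by simp
  also have "\<dots> = (\<integral>u. double_exponential u * f (x + h * u) \<partial>lborel)"
    using assms by (intro Bochner_Integration.integral_cong refl)
      (simp add: loc_scale_kernel_def double_exponential_def)
  finally show ?thesis .
qed

text \<open>Positivity uses that the infimum over the open interval is at least the minimum over its
  compact closure.\<close>

lemma
  assumes cont: "continuous_on UNIV f" and pos: "\<And>x. 0 < f x" and \<delta>: "0 < \<delta>"
  shows local_inf_pos: "0 < local_inf f \<delta> x"
    and local_inf_le: "\<And>t. \<bar>t - x\<bar> < \<delta> \<Longrightarrow> local_inf f \<delta> x \<le> f t"
proof -
  obtain s where s: "s \<in> {x - \<delta>..x + \<delta>}" "\<And>t. t \<in> {x - \<delta>..x + \<delta>} \<Longrightarrow> f s \<le> f t"
    using continuous_attains_inf[of "{x - \<delta>..x + \<delta>}" f] continuous_on_subset[OF cont] \<delta> by auto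
  have "f s \<le> local_inf f \<delta> x"
    unfolding local_inf_def using \<delta> by (intro cINF_greatest) (auto intro!: s(2) exI[of _ x])
  then show "0 < local_inf f \<delta> x" using pos[of s] by linarith
  show "local_inf f \<delta> x \<le> f t" if "\<bar>t - x\<bar> < \<delta>" for t
    unfolding local_inf_def using that pos
    by (intro cINF_lower) (auto simp: bdd_below_def intro!: exI[of _ 0] less_imp_le)
qed

text \<open>An infimum over open intervals of fixed length is upper semicontinuous: a point \<open>t\<close> with
  \<open>f t < a\<close> witnesses \<open>local_inf f \<delta> x < a\<close> for every \<open>x\<close> in the ball of radius
  \<open>\<delta>\<close> around \<open>t\<close>.\<close>

lemma local_inf_measurable:
  assumes pos: "\<And>x. 0 < f x" and \<delta>: "0 < \<delta>"
  shows "local_inf f \<delta> \<in> borel_measurable borel"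
proof (rule borel_measurableI_less)
  fix a
  have "{x \<in> space borel. local_inf f \<delta> x < a} = (\<Union>t\<in>{t. f t < a}. ball t \<delta>)"
  proof -
    have "local_inf f \<delta> x < a \<longleftrightarrow> (\<exists>t\<in>{t. \<bar>t - x\<bar> < \<delta>}. f t < a)" for x
      unfolding local_inf_def using pos \<delta>
    proof (intro cINF_less_iff)
      show "bdd_below (f ` {t. \<bar>t - x\<bar> < \<delta>})"
        using pos by (auto intro!: bdd_belowI[of _ 0] less_imp_le)
    qed (auto intro!: exI[of _ x])
    then show ?thesis by (auto simp: dist_real_def)
  qed
  moreover have "open (\<Union>t\<in>{t. f t < a}. ball t \<delta>)" by (intro open_UN) auto
  ultimately show "{x \<in> space borel. local_inf f \<delta> x < a} \<in> sets borel" by (simp add: borel_open)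
qed

context
  fixes f\<^sub>0 :: "real \<Rightarrow> real" and M :: real
  assumes dens: "is_density f\<^sub>0" and cont: "continuous_on UNIV f\<^sub>0"
    and pos: "\<And>x. 0 < f\<^sub>0 x" and le_M: "\<And>x. f\<^sub>0 x \<le> M"
begin

lemma smoothed_integrable: "integrable lborel (\<lambda>u. double_exponential u * f\<^sub>0 (x + h * u))"
proof (rule Bochner_Integration.integrable_bound)
  note [measurable] = density_borel_measurable[OF dens]
  show "integrable lborel (\<lambda>u. double_exponential u * M)"
    using integrable_density[OF double_exponential_is_density] by simp
  show "(\<lambda>u. double_exponential u * f\<^sub>0 (x + h * u)) \<in> borel_measurable lborel" by measurable
  show "AE u in lborel. norm (double_exponential u * f\<^sub>0 (x + h * u)) \<le> norm (double_exponential u * M)"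
    using pos order_trans[OF le_M abs_ge_self]
    by (auto intro!: mult_left_mono simp: abs_mult less_imp_le)
qed

lemma smoothed_le: "0 < h \<Longrightarrow> smoothed f\<^sub>0 h x \<le> M"
proof -
  assume h: "0 < h"
  have "(\<integral>u. double_exponential u * f\<^sub>0 (x + h * u) \<partial>lborel) \<le> (\<integral>u. double_exponential u * M \<partial>lborel)"
  proof (rule integral_mono[OF smoothed_integrable])
    show "integrable lborel (\<lambda>u. double_exponential u * M)"
      using integrable_density[OF double_exponential_is_density] by simp
  qed (use le_M in \<open>auto intro!: mult_left_mono simp: double_exponential_def\<close>)
  then show ?thesis
    using integral_density_eq_1[OF double_exponential_is_density] by (simp add: smoothed_eq[OF h])
qed

text \<open>At a scale \<open>h \<le> \<delta>\<close> the kernel gives the window of radius \<open>\<delta>\<close> around \<open>x\<close> a mass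
  bounded below independently of \<open>h\<close>. In the variable \<open>u = (\<theta> - x) / h\<close> it is at least
  the mass of \<open>(-1, 1)\<close>, where the standard kernel exceeds \<open>exp (- 1) / 2\<close>.\<close>

lemma smoothed_ge_local_inf:
  assumes h: "0 < h" "h \<le> \<delta>"
  shows "exp (- 1) * local_inf f\<^sub>0 \<delta> x \<le> smoothed f\<^sub>0 h x"
proof -
  define c where "c = exp (- 1) / 2 * local_inf f\<^sub>0 \<delta> x"
  have c: "0 < c" using local_inf_pos[OF cont pos] h by (simp add: c_def)
  have "exp (- 1) * local_inf f\<^sub>0 \<delta> x = (\<integral>u. c * indicator {-1<..<1 :: real} u \<partial>lborel)"
    by (simp add: c_def)
  also have "\<dots> \<le> (\<integral>u. double_exponential u * f\<^sub>0 (x + h * u) \<partial>lborel)"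
  proof (rule integral_mono[OF _ smoothed_integrable])
    show "integrable lborel (\<lambda>u. c * indicator {-1<..<1 :: real} u)"
      by (intro integrable_mult_right integrable_real_indicator) auto
    fix u :: real
    show "c * indicator {-1<..<1} u \<le> double_exponential u * f\<^sub>0 (x + h * u)"
    proof (cases "\<bar>u\<bar> < 1")
      case True
      then have "h * \<bar>u\<bar> < h * 1" using h by (intro mult_strict_left_mono) auto
      then have "h * \<bar>u\<bar> < \<delta>" using h by linarith
      then have "local_inf f\<^sub>0 \<delta> x \<le> f\<^sub>0 (x + h * u)"
        using h by (intro local_inf_le[OF cont pos]) (auto simp: abs_mult)
      moreover have "exp (- 1) / 2 \<le> double_exponential u"
        using True by (simp add: double_exponential_def)
      ultimately have "c \<le> double_exponential u * f\<^sub>0 (x + h * u)"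
        unfolding c_def using local_inf_pos[OF cont pos, of \<delta> x] h
        by (intro mult_mono) (auto simp: double_exponential_def)
      then show ?thesis using True by (simp add: indicator_def abs_less_iff)
    next
      case False
      then show ?thesis using pos[of "x + h * u"]
        by (auto simp: indicator_def double_exponential_def)
    qed
  qed
  also have "\<dots> = smoothed f\<^sub>0 h x" by (simp add: smoothed_eq[OF h(1)])
  finally show ?thesis .
qed

lemma smoothed_pos: "0 < h \<Longrightarrow> 0 < smoothed f\<^sub>0 h x"
  using smoothed_ge_local_inf[of h h x] local_inf_pos[OF cont pos, of h x]
  by (smt (verit) exp_gt_zero mult_pos_pos)

lemma smoothed_tendsto:
  assumes h: "\<And>n. 0 < h n" "h \<longlonglongrightarrow> 0"
  shows "(\<lambda>n. smoothed f\<^sub>0 (h n) x) \<longlonglongrightarrow> f\<^sub>0 x"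
proof -
  note [measurable] = density_borel_measurable[OF dens]
  have "(\<lambda>n. \<integral>u. double_exponential u * f\<^sub>0 (x + h n * u) \<partial>lborel)
      \<longlonglongrightarrow> (\<integral>u. double_exponential u * f\<^sub>0 x \<partial>lborel)"
  proof (rule integral_dominated_convergence[where w = "\<lambda>u. double_exponential u * M"])
    show "integrable lborel (\<lambda>u. double_exponential u * M)"
      using integrable_density[OF double_exponential_is_density] by simp
    have "(\<lambda>n. double_exponential u * f\<^sub>0 (x + h n * u)) \<longlonglongrightarrow> double_exponential u * f\<^sub>0 x" for u
    proof -
      have "(\<lambda>n. x + h n * u) \<longlonglongrightarrow> x + 0 * u" by (intro tendsto_intros h)
      then have "(\<lambda>n. f\<^sub>0 (x + h n * u)) \<longlonglongrightarrow> f\<^sub>0 x"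
        using continuous_on_tendsto_compose[OF cont, of "\<lambda>n. x + h n * u" x] by simp
      then show ?thesis by (intro tendsto_intros)
    qed
    then show "AE u in lborel. (\<lambda>n. double_exponential u * f\<^sub>0 (x + h n * u))
        \<longlonglongrightarrow> double_exponential u * f\<^sub>0 x" by simp
    show "AE u in lborel. norm (double_exponential u * f\<^sub>0 (x + h n * u)) \<le> double_exponential u * M" for n
      using pos le_M by (auto intro!: AE_I2 mult_mono simp: abs_mult less_imp_le double_exponential_def)
  qed measurable
  then show ?thesis
    using integral_density_eq_1[OF double_exponential_is_density] by (simp add: smoothed_eq[OF h(1)])
qed

text \<open>Dominated convergence along \<open>h = \<delta> / (n + 1)\<close>. The integrand
  \<open>f\<^sub>0 * ln (f\<^sub>0 / smoothed f\<^sub>0 h)\<close> tends to 0 pointwise. It is at most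
  \<open>f\<^sub>0 * (1 + ln (f\<^sub>0 / local_inf f\<^sub>0 \<delta>))\<close> by the preceding lower bound on the smoothed
  density and at least \<open>f\<^sub>0 * ln (f\<^sub>0 / M)\<close> because smoothing preserves the bound
  \<open>M\<close>. Both bounds are integrable and do not involve \<open>h\<close>.\<close>

lemma smoothed_KL_small:
  assumes ent: "integrable lborel (\<lambda>x. f\<^sub>0 x * ln (f\<^sub>0 x))"
    and \<delta>: "0 < \<delta>"
    and loc: "(\<integral>\<^sup>+x. ennreal (f\<^sub>0 x * ln (f\<^sub>0 x / local_inf f\<^sub>0 \<delta> x)) \<partial>lborel) < \<infinity>"
    and \<epsilon>: "0 < \<epsilon>"
  obtains h where "0 < h"
    and "integrable lborel (\<lambda>x. f\<^sub>0 x * ln (f\<^sub>0 x / smoothed f\<^sub>0 h x))"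
    and "(\<integral>x. f\<^sub>0 x * ln (f\<^sub>0 x / smoothed f\<^sub>0 h x) \<partial>lborel) < \<epsilon>"
proof -
  note li_pos = local_inf_pos[OF cont pos \<delta>]
  have li_le: "local_inf f\<^sub>0 \<delta> x \<le> f\<^sub>0 x" for x
    using local_inf_le[OF cont pos \<delta>, of x x] \<delta> by simp
  note [measurable] = density_borel_measurable[OF dens] local_inf_measurable[of f\<^sub>0, OF pos \<delta>]
  have loc_int: "integrable lborel (\<lambda>x. f\<^sub>0 x * ln (f\<^sub>0 x / local_inf f\<^sub>0 \<delta> x))"
    using loc li_pos li_le pos
    by (intro integrableI_nonneg) (auto intro!: AE_I2 mult_nonneg_nonneg ln_ge_zero simp: less_imp_le)
  define w where "w x = f\<^sub>0 x * ln (f\<^sub>0 x / local_inf f\<^sub>0 \<delta> x) + f\<^sub>0 x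
    + (\<bar>f\<^sub>0 x * ln (f\<^sub>0 x)\<bar> + f\<^sub>0 x * \<bar>ln M\<bar>)" for x
  have w_int: "integrable lborel w"
    unfolding w_def using loc_int ent integrable_density[OF dens]
    by (intro Bochner_Integration.integrable_add integrable_mult_left integrable_abs) auto
  define h where "h n = \<delta> / real (Suc n)" for n
  have h: "0 < h n" "h n \<le> \<delta>" for n using \<delta> by (auto simp: h_def field_simps)
  have h_lim: "h \<longlonglongrightarrow> 0"
    unfolding h_def by real_asymp
  define s where "s n x = f\<^sub>0 x * ln (f\<^sub>0 x / smoothed f\<^sub>0 (h n) x)" for n x
  have s_meas: "s n \<in> borel_measurable lborel" for n
    unfolding s_def smoothed_eq[OF h(1)] by measurable
  have s_bound: "\<bar>s n x\<bar> \<le> w x" for n x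
  proof -
    have sp: "0 < smoothed f\<^sub>0 (h n) x" by (rule smoothed_pos[OF h(1)])
    have M: "0 < M" using pos[of 0] le_M[of 0] by linarith
    have "ln (exp (- 1) * local_inf f\<^sub>0 \<delta> x) \<le> ln (smoothed f\<^sub>0 (h n) x)"
      using li_pos by (intro ln_mono smoothed_ge_local_inf h) auto
    then have "ln (f\<^sub>0 x / smoothed f\<^sub>0 (h n) x) \<le> ln (f\<^sub>0 x / local_inf f\<^sub>0 \<delta> x) + 1"
      using li_pos[of x] sp pos[of x] by (simp add: ln_div ln_mult)
    from mult_left_mono[OF this, of "f\<^sub>0 x"]
    have up: "s n x \<le> f\<^sub>0 x * ln (f\<^sub>0 x / local_inf f\<^sub>0 \<delta> x) + f\<^sub>0 x"
      using pos[of x] by (simp add: s_def algebra_simps)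
    have "ln (smoothed f\<^sub>0 (h n) x) \<le> ln M"
      using sp by (intro ln_mono smoothed_le h) auto
    then have "ln (f\<^sub>0 x) - \<bar>ln M\<bar> \<le> ln (f\<^sub>0 x / smoothed f\<^sub>0 (h n) x)"
      using sp pos[of x] by (simp add: ln_div)
    from mult_left_mono[OF this, of "f\<^sub>0 x"]
    have low: "f\<^sub>0 x * ln (f\<^sub>0 x) - f\<^sub>0 x * \<bar>ln M\<bar> \<le> s n x"
      using pos[of x] by (simp add: s_def algebra_simps)
    have "0 \<le> f\<^sub>0 x * ln (f\<^sub>0 x / local_inf f\<^sub>0 \<delta> x)"
      using li_pos[of x] li_le[of x] pos[of x] by (intro mult_nonneg_nonneg ln_ge_zero) auto
    moreover have "0 \<le> f\<^sub>0 x * \<bar>ln M\<bar>" using pos[of x] by simp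
    ultimately show ?thesis
      using up low pos[of x] unfolding w_def by linarith
  qed
  have s_int: "integrable lborel (s n)" for n
    using s_bound order_trans[OF s_bound abs_ge_self]
    by (intro Bochner_Integration.integrable_bound[OF w_int s_meas]) auto
  have "(\<lambda>n. \<integral>x. s n x \<partial>lborel) \<longlonglongrightarrow> (\<integral>x. 0 \<partial>(lborel :: real measure))"
  proof (rule integral_dominated_convergence[where w = w])
    have "(\<lambda>n. s n x) \<longlonglongrightarrow> f\<^sub>0 x * ln (f\<^sub>0 x / f\<^sub>0 x)" for x
      unfolding s_def using pos[of x] by (intro tendsto_intros smoothed_tendsto h h_lim) auto
    then show "AE x in lborel. (\<lambda>n. s n x) \<longlonglongrightarrow> 0"
      using pos by (simp add: less_imp_neq[symmetric])
  qed (use s_meas w_int s_bound in auto)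
  then have "\<forall>\<^sub>F n in sequentially. (\<integral>x. s n x \<partial>lborel) < \<epsilon>"
    using \<epsilon> by (intro order_tendstoD(2)) auto
  then obtain n where "(\<integral>x. s n x \<partial>lborel) < \<epsilon>" by (auto simp: eventually_sequentially)
  then show thesis
    using that[OF h(1)[of n]] s_int[of n] unfolding s_def by simp
qed

end

section \<open>Kullback-Leibler balls have positive prior probability\<close>

context
  fixes f\<^sub>0 :: "real \<Rightarrow> real" and M h e \<epsilon> :: real
  assumes dens: "is_density f\<^sub>0" and cont: "continuous_on UNIV f\<^sub>0"
    and pos: "\<And>x. 0 < f\<^sub>0 x" and le_M: "\<And>x. f\<^sub>0 x \<le> M"
    and moment: "integrable lborel (\<lambda>x. \<bar>x\<bar> * f\<^sub>0 x)"
    and h: "0 < h" and e: "0 < e"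
    and KL_int: "integrable lborel (\<lambda>x. f\<^sub>0 x * ln (f\<^sub>0 x / smoothed f\<^sub>0 h x))"
    and KL_small: "(\<integral>x. f\<^sub>0 x * ln (f\<^sub>0 x / smoothed f\<^sub>0 h x) \<partial>lborel) + 3 * e < \<epsilon>"
begin

text \<open>The measure \<open>P\<^sub>0\<close> is the distribution \<open>f\<^sub>0\<close> of \<open>\<theta>\<close> with the scale fixed at
  \<open>h\<close>. The kernel itself is unbounded near the scale 0, and its logarithm has no uniform
  Lipschitz constant there. Multiplying it by a continuous cutoff \<open>w\<close> in the scale cures both.
  The cutoff does not change the mixture at \<open>P\<^sub>0\<close>, because \<open>w h = 1\<close>, and it can only
  decrease all other mixtures, which is harmless for a lower bound.\<close>

lemma KL_ball_pos_I:
  assumes Q: "prior_on_measures (UNIV \<times> {0<..}) Q"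
    and supp: "support_wrt (weak_topology (UNIV \<times> {0<..})) Q = prob_measures (UNIV \<times> {0<..})"
  defines "R \<equiv> mixture_prior_I double_exponential Q"
  shows "0 < emeasure R {f \<in> space R. KL_div f\<^sub>0 f < ereal \<epsilon>}"
proof -
  let ?S = "UNIV \<times> {0<..} :: (real \<times> real) set"
  let ?k = "\<lambda>x (\<theta>, \<phi>). loc_scale_kernel double_exponential \<theta> \<phi> x"
  define N where "N = restrict_space (borel :: (real \<times> real) measure) ?S"
  have sets_Q: "sets Q = sets (sigma (prob_measures ?S) {U. openin (weak_topology ?S) U})"
    using Q by (simp add: prior_on_measures_def)
  have space_N: "space N = ?S" by (simp add: N_def space_restrict_space)
  have k_meas: "(\<lambda>(x, z). ?k x z) \<in> borel_measurable (lborel \<Otimes>\<^sub>M N)"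
  proof -
    have "continuous_on UNIV (fst :: real \<times> real \<Rightarrow> real)" "continuous_on UNIV (snd :: real \<times> real \<Rightarrow> real)"
      by (intro continuous_intros)+
    from this[THEN borel_measurable_continuous_onI, THEN measurable_restrict_space1]
    have [measurable]: "fst \<in> N \<rightarrow>\<^sub>M (borel :: real measure)" "snd \<in> N \<rightarrow>\<^sub>M (borel :: real measure)"
      unfolding N_def .
    show ?thesis
      unfolding loc_scale_kernel_def case_prod_beta by measurable
  qed
  have k_nonneg: "0 \<le> ?k x z" if "z \<in> space N" for x z
    using that by (auto simp: space_N intro: loc_scale_kernel_nonneg)
  have k_one: "(\<integral>\<^sup>+x. ennreal (?k x z) \<partial>lborel) = 1" if "z \<in> space N" for z
    using that by (auto simp: space_N nn_integral_loc_scale_kernel)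
  have in_Q: "prob_space P" "sets P = sets N" if "P \<in> space Q" for P
    using that by (auto simp: space_weak_borel[OF sets_Q] in_prob_measures_iff N_def)
  have mix_density: "is_density (mixture_I double_exponential P)" if "P \<in> space Q" for P
    unfolding mixture_I_def
    by (rule is_density_mixture[OF in_Q[OF that] k_meas k_nonneg k_one])
  have mix_integrable: "AE x in lborel. integrable P (?k x)" if "P \<in> space Q" for P
    by (rule AE_integrable_mixture[OF in_Q[OF that] k_meas k_nonneg k_one])

  \<comment> \<open>A tent with peak 1 at \<open>h\<close>, vanishing outside \<open>(h / 2, 3 * h / 2)\<close>.\<close>
  define w where "w \<phi> = max 0 (1 - \<bar>\<phi> - h\<bar> * (2 / h))" for \<phi>
  define g where "g x z = w (snd z) * ?k x z" for x z
  have w: "0 \<le> w \<phi>" "w \<phi> \<le> 1" for \<phi>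
    using h by (auto simp: w_def)
  have w_zero: "w \<phi> = 0" if "\<phi> < h / 2" for \<phi>
  proof -
    have "1 \<le> \<bar>\<phi> - h\<bar> * (2 / h)" using that h by (auto simp: field_simps abs_if)
    then show ?thesis by (simp add: w_def)
  qed
  have g_le: "0 \<le> g x z" "g x z \<le> ?k x z" if "z \<in> space N" for x z
    using w[of "snd z"] k_nonneg[OF that, of x] unfolding g_def
    by (auto intro: mult_left_le_one_le)
  have g_cont: "continuous_on ?S (g x)" for x
    unfolding g_def w_def case_prod_beta loc_scale_kernel_def double_exponential_def
    by (intro continuous_intros) auto
  have g_bound: "\<bar>g x z\<bar> \<le> 1 / h" if "z \<in> ?S" for x z
  proof (cases "snd z < h / 2")
    case True
    then show ?thesis using h by (simp add: g_def w_zero)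
  next
    case False
    obtain \<theta> \<phi> where z: "z = (\<theta>, \<phi>)" by (cases z)
    have \<phi>: "h / 2 \<le> \<phi>" "0 < \<phi>" using False z h by auto
    have "g x z \<le> ?k x z" "0 \<le> g x z" using g_le[of z x] that by (auto simp: space_N)
    moreover have "exp (- \<bar>x - \<theta>\<bar> / \<phi>) / (2 * \<phi>) \<le> 1 / h"
      using \<phi> h by (intro frac_le) auto
    ultimately show ?thesis using \<phi> by (simp add: z loc_scale_double_exponential)
  qed
  have g_lip: "g x z \<le> exp (2 / h * \<bar>x - y\<bar>) * g y z" if "z \<in> ?S" for x y z
  proof (cases "snd z < h / 2")
    case True
    then show ?thesis by (simp add: g_def w_zero)
  next
    case False
    obtain \<theta> \<phi> where z: "z = (\<theta>, \<phi>)" by (cases z)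
    have "?k x z \<le> exp (2 / h * \<bar>x - y\<bar>) * ?k y z"
      using loc_scale_kernel_log_lipschitz[of "h / 2" \<phi> \<theta> x y] False h z by simp
    then show ?thesis
      using mult_left_mono[OF _ w(1)[of "snd z"]] by (simp add: g_def mult.left_commute)
  qed

  define P\<^sub>0 where "P\<^sub>0 = distr (density lborel f\<^sub>0) N (\<lambda>\<theta>. (\<theta>, h))"
  note f0_meas [measurable] = density_borel_measurable[OF dens]
  have emb: "(\<lambda>\<theta>. (\<theta>, h)) \<in> density lborel f\<^sub>0 \<rightarrow>\<^sub>M N"
    unfolding N_def using h by (intro measurable_restrict_space2) auto
  have "prob_space P\<^sub>0"
    unfolding P\<^sub>0_def by (rule prob_space.prob_space_distr[OF prob_space_density_lborel[OF dens] emb])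
  then have P0: "P\<^sub>0 \<in> prob_measures ?S"
    by (simp add: in_prob_measures_iff P\<^sub>0_def N_def)
  have g_P0: "(\<integral>z. g x z \<partial>P\<^sub>0) = smoothed f\<^sub>0 h x" for x
  proof -
    have "g x \<in> borel_measurable N"
      unfolding N_def by (rule borel_measurable_continuous_on_restrict[OF g_cont])
    then have "(\<integral>z. g x z \<partial>P\<^sub>0) = (\<integral>\<theta>. g x (\<theta>, h) \<partial>density lborel f\<^sub>0)"
      unfolding P\<^sub>0_def by (intro integral_distr emb)
    also have "\<dots> = (\<integral>\<theta>. f\<^sub>0 \<theta> *\<^sub>R g x (\<theta>, h) \<partial>lborel)"
      using pos by (intro integral_density) (auto simp: less_imp_le g_def loc_scale_kernel_def)
    also have "\<dots> = smoothed f\<^sub>0 h x"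
      unfolding smoothed_def by (intro Bochner_Integration.integral_cong) (auto simp: g_def w_def)
    finally show ?thesis .
  qed
  obtain U where U: "openin (weak_topology ?S) U" "P\<^sub>0 \<in> U"
    and close: "\<And>P f. P \<in> U \<Longrightarrow> is_density f \<Longrightarrow>
      (AE x in lborel. (\<integral>z. g x z \<partial>P) \<le> exp e * f x) \<Longrightarrow> KL_div f\<^sub>0 f < ereal \<epsilon>"
  proof (rule weak_nbhd_KL_lt[OF P0 g_cont _ g_lip _ _ dens pos moment _ _ e, where \<epsilon> = \<epsilon>])
    show "bounded (g x ` ?S)" for x
      using g_bound unfolding bounded_iff by (auto intro!: exI[of _ "1 / h"])
    show "0 < (\<integral>z. g x z \<partial>P\<^sub>0)" for x
      unfolding g_P0 by (rule smoothed_pos[OF dens cont pos le_M h])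
  qed (use h KL_int KL_small in \<open>auto simp: g_P0\<close>)
  have U_sets: "U \<in> sets Q" by (rule openin_weak_in_sets[OF sets_Q U(1)])
  have U_pos: "0 < emeasure Q U"
  proof -
    have "P\<^sub>0 \<in> support_wrt (weak_topology ?S) Q" using supp P0 by simp
    then show ?thesis using U by (simp add: support_wrt_def)
  qed
  show ?thesis
    unfolding R_def mixture_prior_I_def
  proof (rule law_on_KL_ball_pos[OF _ _ _ U_sets U_pos])
    fix P assume "P \<in> space Q"
    then show "is_density (mixture_I double_exponential P)" by (rule mix_density)
  next
    show "(\<lambda>(P, x). mixture_I double_exponential P x) \<in> borel_measurable (Q \<Otimes>\<^sub>M lborel)"
      unfolding mixture_I_def
      using mixture_jointly_measurable[OF weak_borel_measurable_prob_algebra[OF sets_Q], folded N_def, OF k_meas k_nonneg]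
      by simp
  next
    fix P assume P: "P \<in> U"
    then have PQ: "P \<in> space Q" using U_sets sets.sets_into_space by blast
    have sp: "space P = space N" by (rule sets_eq_imp_space_eq[OF in_Q(2)[OF PQ]])
    \<comment> \<open>Where the kernel is not integrable the mixture is 0 by convention, so the bound holds only almost everywhere.\<close>
    have "AE x in lborel. (\<integral>z. g x z \<partial>P) \<le> exp e * mixture_I double_exponential P x"
      using mix_integrable[OF PQ]
    proof eventually_elim
      case (elim x)
      have "(\<integral>z. g x z \<partial>P) \<le> (\<integral>z. ?k x z \<partial>P)"
      proof (rule integral_mono_AE'[OF elim])
        show "AE z in P. g x z \<le> ?k x z"
          by (rule AE_I2, rule g_le(2)) (simp add: sp)
        show "AE z in P. 0 \<le> ?k x z"
          by (rule AE_I2, rule k_nonneg) (simp add: sp)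
      qed
      moreover have "0 \<le> (\<integral>z. ?k x z \<partial>P)"
        by (intro integral_nonneg_AE AE_I2 k_nonneg) (simp add: sp)
      ultimately show ?case
        using e mult_right_mono[of 1 "exp e" "\<integral>z. ?k x z \<partial>P"] by (simp add: mixture_I_def)
    qed
    then show "KL_div f\<^sub>0 (mixture_I double_exponential P) < ereal \<epsilon>"
      by (rule close[OF P mix_density[OF PQ]])
  qed (use f0_meas in simp)
qed

text \<open>The event is a product \<open>U \<times> I\<close> with a weak neighbourhood \<open>U\<close> of \<open>P\<^sub>0\<close>, the
  distribution with density \<open>f\<^sub>0\<close>, and the interval \<open>I = (h, h * exp e)\<close> of scales.
  Increasing the scale from \<open>h\<close> to \<open>\<phi>\<close> increases the exponential and divides the
  normalising factor by \<open>\<phi> / h < exp e\<close>. So the kernel of scale \<open>h\<close> is at most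
  \<open>exp e\<close> times the one of scale \<open>\<phi>\<close>, and the neighbourhood can be chosen for the
  kernel of scale \<open>h\<close> alone.\<close>

lemma KL_ball_pos_II:
  assumes Q: "prior_on_measures UNIV Q" and \<mu>: "\<mu> \<in> prob_measures {0<..}"
    and supp: "support_wrt (weak_topology UNIV) Q = prob_measures UNIV"
    and supp_\<mu>: "support_wrt (top_of_set {0<..}) \<mu> = {0<..}"
  defines "R \<equiv> mixture_prior_II double_exponential Q \<mu>"
  shows "0 < emeasure R {f \<in> space R. KL_div f\<^sub>0 f < ereal \<epsilon>}"
proof -
  let ?K = "\<lambda>\<phi> x \<theta>. loc_scale_kernel double_exponential \<theta> \<phi> x"
  have sets_Q: "sets Q = sets (sigma (prob_measures UNIV) {U. openin (weak_topology (UNIV :: real set)) U})"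
    using Q by (simp add: prior_on_measures_def)
  have prob_\<mu>: "prob_space \<mu>" and sets_\<mu>: "sets \<mu> = sets (restrict_space borel {0<..})"
    using \<mu> by (auto simp: in_prob_measures_iff)
  interpret \<mu>: prob_space \<mu> by (rule prob_\<mu>)
  have space_\<mu>: "space \<mu> = {0<..}"
    using sets_eq_imp_space_eq[OF sets_\<mu>] by (simp add: space_restrict_space)
  have [measurable]: "(\<lambda>\<phi>. \<phi>) \<in> borel_measurable \<mu>"
    unfolding measurable_cong_sets[OF sets_\<mu> refl] by (intro measurable_restrict_space1) simp
  have in_Q: "prob_space P" "sets P = sets (borel :: real measure)" if "P \<in> space Q" for P
    using that by (auto simp: space_weak_borel[OF sets_Q] in_prob_measures_iff)
  have mix_density: "is_density (mixture_II double_exponential P \<phi>)"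
    if "P \<in> space Q" "0 < \<phi>" for P \<phi>
    unfolding mixture_II_def
  proof (rule is_density_mixture[OF in_Q[OF that(1)]])
    show "(\<lambda>(x, \<theta>). ?K \<phi> x \<theta>) \<in> borel_measurable (lborel \<Otimes>\<^sub>M borel)"
      unfolding loc_scale_kernel_def by measurable
  qed (use that in \<open>auto simp: loc_scale_kernel_nonneg nn_integral_loc_scale_kernel\<close>)

  have K_cont: "continuous_on UNIV (?K h x)" for x
    using h unfolding loc_scale_kernel_def double_exponential_def by (intro continuous_intros) auto
  have K_bound: "\<bar>?K h x \<theta>\<bar> \<le> 1 / h" for x \<theta>
  proof -
    have "exp (- \<bar>x - \<theta>\<bar> / h) / (2 * h) \<le> 1 / h"
      using h by (intro frac_le) auto
    then show ?thesis using h by (simp add: loc_scale_double_exponential)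
  qed
  define P\<^sub>0 where "P\<^sub>0 = density lborel f\<^sub>0"
  note f0_meas [measurable] = density_borel_measurable[OF dens]
  have P0: "P\<^sub>0 \<in> prob_measures UNIV"
    using prob_space_density_lborel[OF dens] by (simp add: in_prob_measures_iff P\<^sub>0_def)
  have K_P0: "(\<integral>\<theta>. ?K h x \<theta> \<partial>P\<^sub>0) = smoothed f\<^sub>0 h x" for x
  proof -
    have "(\<integral>\<theta>. ?K h x \<theta> \<partial>P\<^sub>0) = (\<integral>\<theta>. f\<^sub>0 \<theta> *\<^sub>R ?K h x \<theta> \<partial>lborel)"
      unfolding P\<^sub>0_def using pos
      by (intro integral_density) (auto simp: less_imp_le loc_scale_kernel_def)
    also have "\<dots> = smoothed f\<^sub>0 h x"
      unfolding smoothed_def by (intro Bochner_Integration.integral_cong) auto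
    finally show ?thesis .
  qed
  obtain U where U: "openin (weak_topology (UNIV :: real set)) U" "P\<^sub>0 \<in> U"
    and close: "\<And>P f. P \<in> U \<Longrightarrow> is_density f \<Longrightarrow>
      (AE x in lborel. (\<integral>\<theta>. ?K h x \<theta> \<partial>P) \<le> exp e * f x) \<Longrightarrow> KL_div f\<^sub>0 f < ereal \<epsilon>"
  proof (rule weak_nbhd_KL_lt[OF P0 K_cont _ loc_scale_kernel_log_lipschitz[OF h order_refl]
        _ _ dens pos moment _ _ e, where \<epsilon> = \<epsilon>])
    show "bounded (range (?K h x))" for x
      using K_bound unfolding bounded_iff by (auto intro!: exI[of _ "1 / h"])
    show "0 < (\<integral>\<theta>. ?K h x \<theta> \<partial>P\<^sub>0)" for x
      unfolding K_P0 by (rule smoothed_pos[OF dens cont pos le_M h])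
  qed (use h KL_int KL_small in \<open>auto simp: K_P0\<close>)
  have U_sets: "U \<in> sets Q" by (rule openin_weak_in_sets[OF sets_Q U(1)])
  have U_pos: "0 < emeasure Q U"
  proof -
    have "P\<^sub>0 \<in> support_wrt (weak_topology UNIV) Q" using supp P0 by simp
    then show ?thesis using U by (simp add: support_wrt_def)
  qed
  define I where "I = {h<..<h * exp e}"
  have "h * 1 < h * exp e" using h e by (intro mult_strict_left_mono) auto
  then obtain \<phi>\<^sub>0 where \<phi>0: "\<phi>\<^sub>0 \<in> I"
    using dense[of h "h * exp e"] by (auto simp: I_def)
  have I_sub: "I \<subseteq> {0<..}" using h by (auto simp: I_def)
  have I_open: "openin (top_of_set {0<..}) I"
    using I_sub by (intro open_subset) (auto simp: I_def)
  have I_sets: "I \<in> sets \<mu>"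
    unfolding sets_\<mu> using I_sub by (subst sets_restrict_space_iff) (auto simp: I_def)
  have I_pos: "0 < emeasure \<mu> I"
  proof -
    have "\<phi>\<^sub>0 \<in> support_wrt (top_of_set {0<..}) \<mu>" using supp_\<mu> \<phi>0 I_sub by auto
    then show ?thesis using I_open \<phi>0 by (simp add: support_wrt_def)
  qed
  show ?thesis
    unfolding R_def mixture_prior_II_def
  proof (rule law_on_KL_ball_pos[where E = "U \<times> I"])
    fix \<omega> assume "\<omega> \<in> space (Q \<Otimes>\<^sub>M \<mu>)"
    then show "is_density (case \<omega> of (P, \<phi>) \<Rightarrow> mixture_II double_exponential P \<phi>)"
      by (auto simp: space_pair_measure space_\<mu> intro: mix_density)
  next
    have k_meas: "(\<lambda>(y, \<theta>). ?K (fst y) (snd y) \<theta>) \<in> borel_measurable ((\<mu> \<Otimes>\<^sub>M lborel) \<Otimes>\<^sub>M borel)"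
      unfolding loc_scale_kernel_def by measurable
    have "restrict_space borel UNIV = (borel :: real measure)"
      by (rule measure_eqI) (simp_all add: emeasure_restrict_space)
    then have "(\<lambda>P. P) \<in> Q \<rightarrow>\<^sub>M prob_algebra (borel :: real measure)"
      using weak_borel_measurable_prob_algebra[OF sets_Q] by metis
    then have "(\<lambda>(P, y). \<integral>\<theta>. ?K (fst y) (snd y) \<theta> \<partial>P) \<in> borel_measurable (Q \<Otimes>\<^sub>M (\<mu> \<Otimes>\<^sub>M lborel))"
      by (rule mixture_jointly_measurable[OF _ k_meas])
         (auto simp: space_pair_measure space_\<mu> loc_scale_kernel_nonneg)
    moreover have "(\<lambda>(\<omega>, x). (fst \<omega>, (snd \<omega>, x))) \<in> (Q \<Otimes>\<^sub>M \<mu>) \<Otimes>\<^sub>M lborel \<rightarrow>\<^sub>M Q \<Otimes>\<^sub>M (\<mu> \<Otimes>\<^sub>M lborel)"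
      by measurable
    ultimately have "(\<lambda>z. case (case z of (\<omega>, x) \<Rightarrow> (fst \<omega>, (snd \<omega>, x))) of
        (P, y) \<Rightarrow> \<integral>\<theta>. ?K (fst y) (snd y) \<theta> \<partial>P) \<in> borel_measurable ((Q \<Otimes>\<^sub>M \<mu>) \<Otimes>\<^sub>M lborel)"
      by (rule measurable_compose[rotated])
    then show "(\<lambda>(\<omega>, x). (case \<omega> of (P, \<phi>) \<Rightarrow> mixture_II double_exponential P \<phi>) x)
        \<in> borel_measurable ((Q \<Otimes>\<^sub>M \<mu>) \<Otimes>\<^sub>M lborel)"
      by (simp add: mixture_II_def case_prod_beta)
  next
    show "U \<times> I \<in> sets (Q \<Otimes>\<^sub>M \<mu>)" using U_sets I_sets by simp
    show "0 < emeasure (Q \<Otimes>\<^sub>M \<mu>) (U \<times> I)"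
      using U_pos I_pos by (simp add: \<mu>.emeasure_pair_measure_Times[OF U_sets I_sets] ennreal_zero_less_mult_iff)
  next
    fix \<omega> assume "\<omega> \<in> U \<times> I"
    then obtain P \<phi> where \<omega>: "\<omega> = (P, \<phi>)" and P: "P \<in> U" and \<phi>: "\<phi> \<in> I" by auto
    have PQ: "P \<in> space Q" using P U_sets sets.sets_into_space by blast
    interpret P: prob_space P by (rule in_Q(1)[OF PQ])
    have \<phi>h: "h < \<phi>" "\<phi> < h * exp e" "0 < \<phi>" using \<phi> h by (auto simp: I_def)
    have K_meas: "?K \<phi>' x \<in> borel_measurable P" for \<phi>' x
      unfolding measurable_cong_sets[OF in_Q(2)[OF PQ] refl] loc_scale_kernel_def by measurable
    have K_int: "integrable P (?K \<phi>' x)" if "0 < \<phi>'" for \<phi>' x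
    proof (rule P.integrable_const_bound[of _ "1 / (2 * \<phi>')"])
      show "AE \<theta> in P. norm (?K \<phi>' x \<theta>) \<le> 1 / (2 * \<phi>')"
        using that by (auto simp: loc_scale_double_exponential intro!: divide_right_mono)
    qed (rule K_meas)
    have "(\<integral>\<theta>. ?K h x \<theta> \<partial>P) \<le> (\<integral>\<theta>. exp e * ?K \<phi> x \<theta> \<partial>P)" for x
    proof (rule integral_mono)
      fix \<theta>
      have "exp (- \<bar>x - \<theta>\<bar> / h) \<le> exp (- \<bar>x - \<theta>\<bar> / \<phi>)"
        using \<phi>h h by (simp add: divide_left_mono)
      moreover have "1 / (2 * h) \<le> exp e / (2 * \<phi>)"
        using \<phi>h h by (simp add: field_simps)
      ultimately have "exp (- \<bar>x - \<theta>\<bar> / h) * (1 / (2 * h)) \<le> exp (- \<bar>x - \<theta>\<bar> / \<phi>) * (exp e / (2 * \<phi>))"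
        using h by (intro mult_mono) auto
      then show "?K h x \<theta> \<le> exp e * ?K \<phi> x \<theta>"
        using \<phi>h h by (simp add: loc_scale_double_exponential mult.commute)
    qed (use K_int h \<phi>h in auto)
    then have "AE x in lborel. (\<integral>\<theta>. ?K h x \<theta> \<partial>P) \<le> exp e * mixture_II double_exponential P \<phi> x"
      by (simp add: mixture_II_def)
    then show "KL_div f\<^sub>0 (case \<omega> of (P, \<phi>) \<Rightarrow> mixture_II double_exponential P \<phi>) < ereal \<epsilon>"
      using close[OF P mix_density[OF PQ \<phi>h(3)]] by (simp add: \<omega>)
  qed (use f0_meas in simp)
qed

end

theorem theorem6:
  fixes R :: "(real \<Rightarrow> real) measure" and f\<^sub>0 :: "real \<Rightarrow> real"
  assumes prior: "type_I_full_support_prior double_exponential R \<or>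
                  type_II_full_support_prior double_exponential R"
    and dens: "is_density f\<^sub>0"
    and cont: "continuous_on UNIV f\<^sub>0"
    and B4: "\<exists>M>0. \<forall>x. 0 < f\<^sub>0 x \<and> f\<^sub>0 x \<le> M"
    and B5: "integrable lborel (\<lambda>x. f\<^sub>0 x * ln (f\<^sub>0 x))"
    and B6: "\<exists>\<delta>>0. (\<integral>\<^sup>+x. ennreal (f\<^sub>0 x * ln (f\<^sub>0 x / local_inf f\<^sub>0 \<delta> x)) \<partial>lborel) < \<infinity>"
    and moment: "\<exists>\<eta>>0. (\<integral>\<^sup>+x. ennreal (\<bar>x\<bar> powr (1 + \<eta>) * f\<^sub>0 x) \<partial>lborel) < \<infinity>"
  shows "f\<^sub>0 \<in> KL_support R"
proof -
  obtain M where pos: "\<And>x. 0 < f\<^sub>0 x" and le_M: "\<And>x. f\<^sub>0 x \<le> M" using B4 by blast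
  obtain \<delta> where \<delta>: "0 < \<delta>"
    and loc: "(\<integral>\<^sup>+x. ennreal (f\<^sub>0 x * ln (f\<^sub>0 x / local_inf f\<^sub>0 \<delta> x)) \<partial>lborel) < \<infinity>"
    using B6 by blast
  obtain \<eta> where \<eta>: "0 < \<eta>"
    and mom: "(\<integral>\<^sup>+x. ennreal (\<bar>x\<bar> powr (1 + \<eta>) * f\<^sub>0 x) \<partial>lborel) < \<infinity>"
    using moment by blast
  note [measurable] = density_borel_measurable[OF dens]
  have "integrable lborel (\<lambda>x. \<bar>x\<bar> powr (1 + \<eta>) * f\<^sub>0 x)"
    using mom pos by (intro integrableI_nonneg) (auto simp: less_imp_le)
  then have "integrable lborel (\<lambda>x. f\<^sub>0 x + \<bar>x\<bar> powr (1 + \<eta>) * f\<^sub>0 x)"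
    using integrable_density[OF dens] by simp
  \<comment> \<open>The moment of order \<open>1 + \<eta>\<close> controls the first one, since \<open>\<bar>x\<bar> \<le> 1 + \<bar>x\<bar> powr (1 + \<eta>)\<close>.\<close>
  then have first_moment: "integrable lborel (\<lambda>x. \<bar>x\<bar> * f\<^sub>0 x)"
  proof (rule Bochner_Integration.integrable_bound)
    have "\<bar>x\<bar> * f\<^sub>0 x \<le> f\<^sub>0 x + \<bar>x\<bar> powr (1 + \<eta>) * f\<^sub>0 x" for x
    proof -
      have "\<bar>x\<bar> \<le> 1 + \<bar>x\<bar> powr (1 + \<eta>)"
      proof (cases "\<bar>x\<bar> \<le> 1")
        case False
        then have "\<bar>x\<bar> powr 1 \<le> \<bar>x\<bar> powr (1 + \<eta>)" using \<eta> by (intro powr_mono) auto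
        then show ?thesis using False by simp
      qed (simp add: add_increasing2)
      from mult_right_mono[OF this, of "f\<^sub>0 x"] show ?thesis
        using pos[of x] by (simp add: algebra_simps)
    qed
    then show "AE x in lborel. norm (\<bar>x\<bar> * f\<^sub>0 x) \<le> norm (f\<^sub>0 x + \<bar>x\<bar> powr (1 + \<eta>) * f\<^sub>0 x)"
      using pos by (auto simp: abs_mult less_imp_le intro: order_trans[OF _ abs_ge_self])
  qed measurable
  have "0 < emeasure R {f \<in> space R. KL_div f\<^sub>0 f < ereal \<epsilon>}" if "0 < \<epsilon>" for \<epsilon>
  proof -
    obtain h where h: "0 < h"
      and KL_int: "integrable lborel (\<lambda>x. f\<^sub>0 x * ln (f\<^sub>0 x / smoothed f\<^sub>0 h x))"
      and KL_less: "(\<integral>x. f\<^sub>0 x * ln (f\<^sub>0 x / smoothed f\<^sub>0 h x) \<partial>lborel) < \<epsilon> / 2"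
      using smoothed_KL_small[OF dens cont pos le_M B5 \<delta> loc, of "\<epsilon> / 2"] \<open>0 < \<epsilon>\<close> by auto
    \<comment> \<open>The smoothing costs \<open>\<epsilon> / 2\<close> and the neighbourhood three times \<open>\<epsilon> / 8\<close>.\<close>
    have e: "0 < \<epsilon> / 8"
      and KL_small: "(\<integral>x. f\<^sub>0 x * ln (f\<^sub>0 x / smoothed f\<^sub>0 h x) \<partial>lborel) + 3 * (\<epsilon> / 8) < \<epsilon>"
      using KL_less \<open>0 < \<epsilon>\<close> by auto
    note pos_I = KL_ball_pos_I[OF dens cont pos le_M first_moment h e KL_int KL_small]
    note pos_II = KL_ball_pos_II[OF dens cont pos le_M first_moment h e KL_int KL_small]
    from prior show ?thesis
      unfolding type_I_full_support_prior_def type_II_full_support_prior_def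
      using pos_I pos_II by blast
  qed
  then show ?thesis by (simp add: KL_support_def)
qed

end
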